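(* Consider the equation $$x''(t)+p(t)x(t-\tau(t))=0,\qquad t\ge s.$$ Assume $p(t)\le 0$ for $t\in\mathbb{R}$, $\int_0^\infty|p(t)|\,dt=\infty$ and $$\tau_m\sqrt{\operatorname{ess\,sup}_{t\in\mathbb{R}}|p(t)|}<\gamma ,$$ where $\gamma$ is the unique solution of $\Psi(1,\gamma)=\gamma\in[\sqrt2,\tfrac{\pi}{2}]$. Then any given solution $x$ of the equation has exactly one of the following asymptotic behaviors: (i) $x$ is oscillatory and $\lim_{t\to\infty}x(t)=0$; (ii) $x$ is nonoscillatory, tends to zero monotonically, and $\lim_{t\to\infty}x'(t)=0$; (iii) $\lim_{t\to\infty}x(t)=\lim_{t\to\infty}x'(t)=+\infty$; (iv) $\lim_{t\to\infty}x(t)=\lim_{t\to\infty}x'(t)=-\infty$. If, furthermore, $\tau_m\sqrt{\operatorname{ess\,sup}_{t\in\mathbb{R}}|p(t)|}\le\frac{2}{e}$, then there must exist solutions exhibiting (ii).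
   Context: Equation and solutions. $\tau:\mathbb{R}\to[0,+\infty)$ and $p:\mathbb{R}\to\mathbb{R}$ are Lebesgue measurable and essentially bounded. $\tau_m:=\operatorname{ess\,sup}\{\tau(t):t\ge s\}$. A solution on $[s,+\infty)$ is a function $x:[s-\tau_m,+\infty)\to\mathbb{R}$, absolutely continuous together with its first derivative, satisfying the equation a.e. on $[s,+\infty)$. A function is oscillatory if it has arbitrarily large zeros, and nonoscillatory otherwise. The function $r_\Delta$ and the number $\vartheta_\Delta$. For $\Delta\ge 0$, $r_\Delta:\mathbb{R}\to\mathbb{R}$ is the solution of $r_\Delta''(t)+r_\Delta(t-\Delta)=0$ for $t\ge 0$, with $r_\Delta(t)=1$ for $t\le 0$ and $r_\Delta'(0)=0$. $\vartheta_\Delta>0$ denotes its first zero (it is known that $r_\Delta$ is strictly decreasing on $[0,\vartheta_\Delta]$ and that $\vartheta_\Delta\geq\sqrt2$ is continuous in $\Delta$; for $\Delta=0$, $r_0=\cos$ on $[0,+\infty)$ and $\vartheta_0=\pi/2$). The number $\Psi(\rho,\Delta)$. Let $\chi_S$ be the characteristic function of $S\subset\mathbb{R}$. For $\Delta\in[0,+\infty)$, $\rho\in(0,+\infty)$ set $\beta_0(t)\equiv 1$ for $t\le 0$ and, for $n=0,1,2,\dots$, let $\varpi_n\in(0,+\infty)$ be the unique number with $$\int_{-\varpi_n}^{0}\Big[\int_{-\varpi_n}^{u}\max\{\beta_n(v),\rho\, r_\Delta(\vartheta_\Delta-v-\Delta)\chi_{[-\Delta,0]}(v)\}\,dv\Big]du=1,$$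 and put $\beta_{n+1}(t)=1$ for $t\le-\varpi_n$ and $$\beta_{n+1}(t)=1-\int_{-\varpi_n}^{t}\Big[\int_{-\varpi_n}^{u}\max\{\beta_n(v),\rho\, r_\Delta(\vartheta_\Delta-v-\Delta)\chi_{[-\Delta,0]}(v)\}\,dv\Big]du,\qquad t\in[-\varpi_n,0].$$ The sequence $\varpi_n$ is well-defined, nondecreasing and bounded, and $\Psi(\rho,\Delta):=\lim_{n\to\infty}\varpi_n$. The function $\Delta\mapsto\Psi(1,\Delta)$ is continuous and nonincreasing, so that the equation $\Psi(1,\gamma)=\gamma$ has a unique solution $\gamma$, and it lies in $[\sqrt2,\pi/2]$. *)

theory Defs
  imports "HOL-Analysis.Analysis" "HOL-Probability.Essential_Supremum"
begin

definition ess_bounded :: "(real \<Rightarrow> real) \<Rightarrow> bool" where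
  "ess_bounded f \<longleftrightarrow> esssup lebesgue (\<lambda>t. ereal \<bar>f t\<bar>) < \<infinity>"

text \<open>The real-valued essential supremum; it is only meaningful for functions that are
  measurable and essentially bounded on a set of positive measure.\<close>

definition ess_sup_on :: "real set \<Rightarrow> (real \<Rightarrow> real) \<Rightarrow> real" where
  "ess_sup_on S f = real_of_ereal (esssup (lebesgue_on S) (\<lambda>t. ereal (f t)))"

definition max_delay :: "(real \<Rightarrow> real) \<Rightarrow> real \<Rightarrow> real" where
  "max_delay \<tau> s = ess_sup_on {s..} \<tau>"

definition abs_cont_on :: "real \<Rightarrow> real \<Rightarrow> (real \<Rightarrow> real) \<Rightarrow> bool" where
  "abs_cont_on a b f \<longleftrightarrow> (\<forall>\<epsilon>>0. \<exists>\<delta>>0. \<forall>(n::nat) u v.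
     (\<forall>i<n. a \<le> u i \<and> u i \<le> v i \<and> v i \<le> b) \<and>
     (\<forall>i<n. \<forall>j<n. i \<noteq> j \<longrightarrow> {u i<..<v i} \<inter> {u j<..<v j} = {}) \<and>
     (\<Sum>i<n. v i - u i) < \<delta> \<longrightarrow>
     (\<Sum>i<n. \<bar>f (v i) - f (u i)\<bar>) < \<epsilon>)"

text \<open>Absolute continuity on an unbounded interval is understood on compact subintervals.\<close>

definition loc_abs_cont_from :: "real \<Rightarrow> (real \<Rightarrow> real) \<Rightarrow> bool" where
  "loc_abs_cont_from a f \<longleftrightarrow> (\<forall>b\<ge>a. abs_cont_on a b f)"

text \<open>Solutions of \<open>x''(t) + p(t) x(t - \<tau>(t)) = 0\<close> on \<open>[s, \<infinity>)\<close>. A solution is a function on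
  \<open>[s - \<tau>\<^sub>m, \<infinity>)\<close>; the values of \<open>x\<close> to the left of this interval play no role, since
  \<open>t - \<tau>(t) \<ge> s - \<tau>\<^sub>m\<close> for almost every \<open>t \<ge> s\<close>. The function \<open>y\<close> is the derivative of \<open>x\<close>,
  one-sided at the left end point.\<close>

definition is_solution :: "(real \<Rightarrow> real) \<Rightarrow> (real \<Rightarrow> real) \<Rightarrow> real \<Rightarrow> (real \<Rightarrow> real) \<Rightarrow> bool" where
  "is_solution p \<tau> s x \<longleftrightarrow>
     (let a = s - max_delay \<tau> s in
       loc_abs_cont_from a x \<and>
       (\<exists>y. (\<forall>t\<ge>a. (x has_real_derivative y t) (at t within {a..})) \<and>
            loc_abs_cont_from a y \<and>
            (AE t in lebesgue. t \<ge> s \<longrightarrow>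
              (\<exists>z. (y has_real_derivative z) (at t) \<and> z + p t * x (t - \<tau> t) = 0))))"

definition oscillatory :: "(real \<Rightarrow> real) \<Rightarrow> bool" where
  "oscillatory x \<longleftrightarrow> (\<forall>T. \<exists>t\<ge>T. x t = 0)"

text \<open>Monotonicity is asymptotic: the initial segment of a solution is arbitrary.\<close>

definition eventually_monotone :: "(real \<Rightarrow> real) \<Rightarrow> bool" where
  "eventually_monotone x \<longleftrightarrow> (\<exists>T. mono_on {T..} x \<or> antimono_on {T..} x)"

datatype behaviour =
  Oscillatory_Decay | Monotone_Decay | To_Plus_Infinity | To_Minus_Infinity

fun exhibits :: "(real \<Rightarrow> real) \<Rightarrow> behaviour \<Rightarrow> bool" where
  "exhibits x Oscillatory_Decay \<longleftrightarrow> oscillatory x \<and> (x \<longlongrightarrow> 0) at_top"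
| "exhibits x Monotone_Decay \<longleftrightarrow>
     \<not> oscillatory x \<and> eventually_monotone x \<and> (x \<longlongrightarrow> 0) at_top \<and> (deriv x \<longlongrightarrow> 0) at_top"
| "exhibits x To_Plus_Infinity \<longleftrightarrow>
     filterlim x at_top at_top \<and> filterlim (deriv x) at_top at_top"
| "exhibits x To_Minus_Infinity \<longleftrightarrow>
     filterlim x at_bot at_top \<and> filterlim (deriv x) at_bot at_top"

text \<open>The solution of \<open>r''(t) + r(t - \<Delta>) = 0\<close> for \<open>t \<ge> 0\<close> with \<open>r = 1\<close> on \<open>(-\<infinity>, 0]\<close> and
  \<open>r'(0) = 0\<close>. The second derivative jumps at \<open>0\<close>, hence the derivatives relative to
  \<open>[0, \<infinity>)\<close>.\<close>

definition r_fun :: "real \<Rightarrow> real \<Rightarrow> real" where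
  "r_fun \<Delta> = (THE r. (\<forall>t\<le>0. r t = 1) \<and>
     (\<exists>r'. r' 0 = 0 \<and>
       (\<forall>t\<ge>0. (r has_real_derivative r' t) (at t within {0..}) \<and>
         (\<exists>z. (r' has_real_derivative z) (at t within {0..}) \<and> z + r (t - \<Delta>) = 0))))"

definition first_zero :: "real \<Rightarrow> real" where
  "first_zero \<Delta> = (LEAST t. 0 < t \<and> r_fun \<Delta> t = 0)"

definition kernel :: "real \<Rightarrow> real \<Rightarrow> (real \<Rightarrow> real) \<Rightarrow> real \<Rightarrow> real" where
  "kernel \<rho> \<Delta> \<beta> v =
     max (\<beta> v) (\<rho> * r_fun \<Delta> (first_zero \<Delta> - v - \<Delta>) * indicator {-\<Delta>..0} v)"

definition varpi_of :: "real \<Rightarrow> real \<Rightarrow> (real \<Rightarrow> real) \<Rightarrow> real" where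
  "varpi_of \<rho> \<Delta> \<beta> =
     (THE w. 0 < w \<and> integral {-w..0} (\<lambda>u. integral {-w..u} (kernel \<rho> \<Delta> \<beta>)) = 1)"

text \<open>Only the values of \<open>beta_seq \<rho> \<Delta> n\<close> on \<open>(-\<infinity>, 0]\<close> are relevant.\<close>

primrec beta_seq :: "real \<Rightarrow> real \<Rightarrow> nat \<Rightarrow> real \<Rightarrow> real" where
  "beta_seq \<rho> \<Delta> 0 = (\<lambda>t. 1)"
| "beta_seq \<rho> \<Delta> (Suc n) =
     (let \<beta> = beta_seq \<rho> \<Delta> n; w = varpi_of \<rho> \<Delta> \<beta> in
       (\<lambda>t. if t \<le> -w then 1
            else 1 - integral {-w..t} (\<lambda>u. integral {-w..u} (kernel \<rho> \<Delta> \<beta>))))"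

definition varpi :: "real \<Rightarrow> real \<Rightarrow> nat \<Rightarrow> real" where
  "varpi \<rho> \<Delta> n = varpi_of \<rho> \<Delta> (beta_seq \<rho> \<Delta> n)"

definition Psi :: "real \<Rightarrow> real \<Rightarrow> real" where
  "Psi \<rho> \<Delta> = lim (varpi \<rho> \<Delta>)"

end

theory Submission
  imports Defs
begin

text \<open>Put \<open>q = - p\<close>, \<open>P = ess sup q\<close> and \<open>h = \<tau>\<^sub>m\<close>. The number \<open>\<gamma>\<close> enters only through
  \<open>\<gamma> \<le> \<pi> / 2 < 8 / 5\<close>. An eventually positive solution is eventually convex, and \<open>\<integral> q = \<infinity>\<close> leaves only
  monotone decay or growth to infinity. For an oscillatory solution, an extremum at \<open>c\<close> must be
  preceded by a zero \<open>a > c - h\<close>, since otherwise the solution would keep its sign. On \<open>[a, c]\<close> the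
  graph is bent back only by values taken before \<open>a\<close>, which are bounded by \<open>M = sup |x|\<close> and reach
  \<open>0\<close> at \<open>a\<close> with slope at most \<open>2 M sqrt P\<close>; integrating twice gives \<open>|x c| \<le> 93 / 100 * M\<close>.

  For \<open>h * sqrt P \<le> 2 / e\<close> there is \<open>\<kappa>\<close> with \<open>P * exp (\<kappa> * h) \<le> \<kappa>\<^sup>2\<close> and \<open>\<kappa> * h \<le> 2\<close>, so that
  \<open>exp (- \<kappa> * t)\<close> is a supersolution, and a decaying solution is found by shooting.\<close>

text \<open>The obstacle for oscillatory solutions is that \<open>x'' \<ge> - P * M\<close> alone
  does not contract: two integrations over a length \<open>8 / 5 * l\<close>, with
  \<open>l = 1 / sqrt P\<close>, give the factor (8/5)^2 / 2 = 32/25. Hence the second bound from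
  the slope before \<open>a\<close>. Forced values lie at most \<open>8 / 5 * l - (t - a)\<close> to
  the left of \<open>a\<close>, so this bound improves linearly in \<open>t\<close> and is the
  better one once \<open>t - a\<close> exceeds \<open>11 / 10 * l\<close>. Using each bound on its
  own range gives 22/25 + 1/24 < 93/100.

  The threshold \<open>2 / e\<close> is the condition for a real decay rate:
  \<open>\<kappa>\<^sup>2 * exp (- \<kappa> * h)\<close> is largest at
  \<open>\<kappa> = 2 / h\<close>, with value \<open>(2 / (e * h))\<^sup>2\<close>. The extra
  condition \<open>\<kappa> * h \<le> 2\<close> keeps the delayed term below the growth term
  \<open>2 * \<kappa> * k\<close> in the inequality for \<open>k\<close>, the negative derivative of
  \<open>x t * exp (\<kappa> * (t - s))\<close>. Once positive, \<open>k\<close> can then never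
  return to 0, which is what excludes double zeros in the shooting argument.

  Since \<open>x''\<close> exists only almost everywhere, all comparisons are made in integrated
  form.\<close>

subsection \<open>Absolutely continuous functions\<close>

text \<open>The definition indexes families by an initial segment of the naturals; a bijection with
  \<open>{..<card I}\<close> lets the tagged pieces of a division be their own index set.\<close>

lemma abs_cont_on_finite_family:
  assumes f: "abs_cont_on a b f" and "\<epsilon> > 0"
  shows "\<exists>\<delta>>0. \<forall>(I :: 'i set) u v. finite I \<and> (\<forall>i\<in>I. a \<le> u i \<and> u i \<le> v i \<and> v i \<le> b) \<and>
       disjoint_family_on (\<lambda>i. {u i<..<v i}) I \<and> (\<Sum>i\<in>I. v i - u i) < \<delta>
     \<longrightarrow> (\<Sum>i\<in>I. \<bar>f (v i) - f (u i)\<bar>) < \<epsilon>"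
proof -
  obtain \<delta> where "\<delta> > 0" and *: "\<forall>(n::nat) u v. (\<forall>i<n. a \<le> u i \<and> u i \<le> v i \<and> v i \<le> b) \<and>
     (\<forall>i<n. \<forall>j<n. i \<noteq> j \<longrightarrow> {u i<..<v i} \<inter> {u j<..<v j} = {}) \<and>
     (\<Sum>i<n. v i - u i) < \<delta> \<longrightarrow> (\<Sum>i<n. \<bar>f (v i) - f (u i)\<bar>) < \<epsilon>"
    using f[unfolded abs_cont_on_def, rule_format, OF \<open>\<epsilon> > 0\<close>] by (elim exE conjE)
  note \<delta> = *[rule_format, OF conjI[OF _ conjI]]
  have "(\<Sum>i\<in>I. \<bar>f (v i) - f (u i)\<bar>) < \<epsilon>"
    if I: "finite I" and uv: "\<And>i. i \<in> I \<Longrightarrow> a \<le> u i \<and> u i \<le> v i \<and> v i \<le> b"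
      and disj: "disjoint_family_on (\<lambda>i. {u i<..<v i}) I" and len: "(\<Sum>i\<in>I. v i - u i) < \<delta>"
    for I :: "'i set" and u v
  proof -
    obtain g where g: "bij_betw g {..<card I} I"
      using ex_bij_betw_nat_finite[OF I] by (auto simp: atLeast0LessThan)
    have mem: "g i \<in> I" if "i < card I" for i
      using g that by (auto dest: bij_betwE)
    have "(\<Sum>i<card I. v (g i) - u (g i)) < \<delta>"
      using len sum.reindex_bij_betw[OF g, of "\<lambda>i. v i - u i"] by simp
    moreover have "{u (g i)<..<v (g i)} \<inter> {u (g j)<..<v (g j)} = {}"
      if "i < card I" "j < card I" "i \<noteq> j" for i j
    proof -
      have "g i \<noteq> g j"
        using g that by (auto simp: bij_betw_def inj_on_def)
      then show ?thesis
        using disj mem that unfolding disjoint_family_on_def by blast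
    qed
    ultimately have "(\<Sum>i<card I. \<bar>f (v (g i)) - f (u (g i))\<bar>) < \<epsilon>"
      using uv mem by (intro \<delta>) auto
    then show ?thesis
      using sum.reindex_bij_betw[OF g, of "\<lambda>i. \<bar>f (v i) - f (u i)\<bar>"] by simp
  qed
  with \<open>\<delta> > 0\<close> show ?thesis by (intro exI[of _ \<delta>]) simp
qed

text \<open>The tags in the exceptional null set are confined to an open set of small measure, so that
  absolute continuity controls their contribution to the Riemann sums.\<close>

theorem abs_cont_on_has_integral:
  fixes f :: "real \<Rightarrow> real"
  assumes f: "abs_cont_on a b f" and "a \<le> b"
    and der: "AE t in lebesgue. t \<in> {a..b} \<longrightarrow> (f has_real_derivative g t) (at t within {a..b})"
  shows "(g has_integral (f b - f a)) {a..b}"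
proof -
  define N where "N = {t \<in> {a..b}. \<not> (f has_real_derivative g t) (at t within {a..b})}"
  obtain N' where N': "N' \<in> null_sets lebesgue" "N \<subseteq> N'"
    using der unfolding N_def eventually_ae_filter by (auto simp: subset_eq)
  have negl: "negligible N"
    using N' negligible_iff_null_sets negligible_subset by blast
  \<comment> \<open>With value 0 on \<open>N\<close>, a tag in \<open>N\<close> leaves only the
    increment of \<open>f\<close> as error, whatever \<open>g\<close> is there.\<close>
  define g' where "g' = (\<lambda>t. if t \<in> N then 0 else g t)"
  have "(g' has_integral (f b - f a)) {a..b}"
    unfolding has_integral_real
  proof (intro allI impI)
    fix e :: real assume "e > 0"
    \<comment> \<open>The summand 1 keeps the denominator positive when
      \<open>a = b\<close>.\<close>
    define e1 where "e1 = e / (2 * (b - a + 1))"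
    have "e1 > 0" "e1 * (b - a) < e / 2"
      using \<open>e > 0\<close> \<open>a \<le> b\<close> by (auto simp: e1_def field_simps)
    obtain d where "d > 0" and *: "\<forall>(I :: (real \<times> real set) set) u v.
        finite I \<and> (\<forall>i\<in>I. a \<le> u i \<and> u i \<le> v i \<and> v i \<le> b) \<and>
        disjoint_family_on (\<lambda>i. {u i<..<v i}) I \<and> (\<Sum>i\<in>I. v i - u i) < d
        \<longrightarrow> (\<Sum>i\<in>I. \<bar>f (v i) - f (u i)\<bar>) < e / 2"
      using abs_cont_on_finite_family[OF f half_gt_zero[OF \<open>e > 0\<close>]] by (elim exE conjE)
    note d = *[rule_format, OF conjI[OF _ conjI[OF _ conjI]]]
    obtain U where U: "open U" "N \<subseteq> U" "U - N \<in> lmeasurable" "emeasure lebesgue (U - N) < ennreal d"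
      using sets_lebesgue_outer_open[OF _ \<open>d > 0\<close>, of N] negl by (metis negligible_imp_sets)
    have Um: "U \<in> lmeasurable"
      using U negl by (metis fmeasurable.Un negligible_imp_measurable Diff_partition sup_commute)
    have "measure lebesgue U = measure lebesgue (U - N)"
      using negl Um by (simp add: fmeasurableD measure_Diff_null_set negligible_iff_null_sets)
    also have "\<dots> < d"
      using U by (metis emeasure_eq_measure2 ennreal_less_iff measure_nonneg)
    finally have mU: "measure lebesgue U < d" .
    have "\<forall>x. \<exists>r>0. x \<in> {a..b} - N \<longrightarrow>
       (\<forall>y\<in>{a..b}. \<bar>y - x\<bar> < r \<longrightarrow> \<bar>f y - f x - g x * (y - x)\<bar> \<le> e1 * \<bar>y - x\<bar>)"
    proof
      fix x
      show "\<exists>r>0. x \<in> {a..b} - N \<longrightarrow>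
       (\<forall>y\<in>{a..b}. \<bar>y - x\<bar> < r \<longrightarrow> \<bar>f y - f x - g x * (y - x)\<bar> \<le> e1 * \<bar>y - x\<bar>)"
      proof (cases "x \<in> {a..b} - N")
        case True
        then have "(f has_derivative (*) (g x)) (at x within {a..b})"
          unfolding N_def has_field_derivative_def by auto
        then show ?thesis
          using \<open>e1 > 0\<close> unfolding has_derivative_within_alt by (auto simp: mult.commute)
      qed (auto intro: exI[of _ 1])
    qed
    then obtain r where r: "\<And>x. r x > 0" "\<And>x y. \<lbrakk>x \<in> {a..b} - N; y \<in> {a..b}; \<bar>y - x\<bar> < r x\<rbrakk>
        \<Longrightarrow> \<bar>f y - f x - g x * (y - x)\<bar> \<le> e1 * \<bar>y - x\<bar>"
      by metis
    define \<gamma> where "\<gamma> = (\<lambda>x. if x \<in> N then U else ball x (r x))"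
    have "gauge \<gamma>"
      using U r(1) unfolding gauge_def \<gamma>_def by auto
    moreover have "norm ((\<Sum>(x, K)\<in>D. measure lborel K *\<^sub>R g' x) - (f b - f a)) < e"
      if D: "D tagged_division_of {a..b}" and fine: "\<gamma> fine D" for D
    proof -
      have finD: "finite D" using D by blast
      have K: "\<exists>u v. K = {u..v} \<and> u \<le> v \<and> a \<le> u \<and> v \<le> b \<and> x \<in> {u..v}" if xK: "(x, K) \<in> D" for x K
      proof -
        obtain u v where uv: "K = cbox u v" "x \<in> K" "K \<subseteq> {a..b}"
          using tagged_division_ofD(2)[OF D xK] tagged_division_ofD(3)[OF D xK] tagged_division_ofD(4)[OF D xK] by metis
        then show ?thesis by (auto simp: box_real)
      qed
      define D1 where "D1 = {(x, K) \<in> D. x \<in> N}"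
      \<comment> \<open>\<open>E\<close> is the error of one tagged piece. Differentiability
        controls it for tags outside \<open>N\<close>, absolute continuity for the pieces in
        \<open>D1\<close>, which all lie in \<open>U\<close>.\<close>
      define E where "E = (\<lambda>(x, K). measure lborel K * g' x - (f (Sup K) - f (Inf K)))"
      have D1: "D1 \<subseteq> D" "finite D1"
        using finD by (auto simp: D1_def intro: finite_subset)
      have "(\<Sum>(x, K)\<in>D. measure lborel K *\<^sub>R g' x) - (f b - f a) = (\<Sum>z\<in>D. E z)"
        unfolding additive_tagged_division_1[OF \<open>a \<le> b\<close> D, symmetric] E_def
        by (simp add: sum_subtractf split_def)
      also have "\<dots> = (\<Sum>z\<in>D1. E z) + (\<Sum>z\<in>D - D1. E z)"
        using D1 finD by (metis sum.subset_diff add.commute)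
      finally have eq: "(\<Sum>(x, K)\<in>D. measure lborel K *\<^sub>R g' x) - (f b - f a) = (\<Sum>z\<in>D1. E z) + (\<Sum>z\<in>D - D1. E z)" .
      have "\<bar>\<Sum>z\<in>D - D1. E z\<bar> \<le> (\<Sum>z\<in>D - D1. e1 * (Sup (snd z) - Inf (snd z)))"
      proof (rule order_trans[OF sum_abs sum_mono])
        fix z assume z: "z \<in> D - D1"
        obtain x J where zx: "z = (x, J)" by fastforce
        obtain u v where uv: "J = {u..v}" "u \<le> v" "a \<le> u" "v \<le> b" "x \<in> {u..v}"
          using K z zx by blast
        have x: "x \<in> {a..b} - N" "x \<notin> N"
          using z zx uv by (auto simp: D1_def)
        have "J \<subseteq> ball x (r x)"
          using fine z zx x(2) unfolding fine_def \<gamma>_def by force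
        then have "u \<in> ball x (r x)" "v \<in> ball x (r x)"
          using uv(2) unfolding uv(1) by (meson atLeastAtMost_iff order_refl subsetD)+
        then have "\<bar>u - x\<bar> < r x" "\<bar>v - x\<bar> < r x"
          by (auto simp: dist_real_def)
        then have "\<bar>f u - f x - g x * (u - x)\<bar> \<le> e1 * (x - u)" "\<bar>f v - f x - g x * (v - x)\<bar> \<le> e1 * (v - x)"
          using r(2)[OF x(1), of u] r(2)[OF x(1), of v] uv by auto
        \<comment> \<open>Straddle estimate: as \<open>u \<le> x \<le> v\<close>, the two one-sided
          errors add up to \<open>e1 * (v - u)\<close>.\<close>
        then have "\<bar>(v - u) * g x - (f v - f u)\<bar> \<le> e1 * (v - u)"
          by (simp add: abs_le_iff algebra_simps)
        then show "\<bar>E z\<bar> \<le> e1 * (Sup (snd z) - Inf (snd z))"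
          using uv x zx by (simp add: E_def g'_def)
      qed
      also have "\<dots> \<le> (\<Sum>z\<in>D. e1 * (Sup (snd z) - Inf (snd z)))"
        using K \<open>e1 > 0\<close> by (intro sum_mono2[OF finD]) fastforce+
      also have "\<dots> = e1 * (b - a)"
        using additive_tagged_division_1[OF \<open>a \<le> b\<close> D, of "\<lambda>x. x"]
        by (simp add: split_def sum_distrib_left[symmetric])
      finally have s2: "\<bar>\<Sum>z\<in>D - D1. E z\<bar> < e / 2"
        using \<open>e1 * (b - a) < e / 2\<close> by simp
      have K1: "\<exists>u v. snd z = {u..v} \<and> u \<le> v \<and> a \<le> u \<and> v \<le> b" if "z \<in> D1" for z
        using K[of "fst z" "snd z"] subsetD[OF D1(1) that] by auto
      have "\<bar>\<Sum>z\<in>D1. E z\<bar> \<le> (\<Sum>z\<in>D1. \<bar>f (Sup (snd z)) - f (Inf (snd z))\<bar>)"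
      proof (rule order_trans[OF sum_abs sum_mono])
        fix z assume "z \<in> D1"
        then show "\<bar>E z\<bar> \<le> \<bar>f (Sup (snd z)) - f (Inf (snd z))\<bar>"
          by (auto simp: E_def g'_def D1_def)
      qed
      also have "\<dots> < e / 2"
      proof (rule d[OF D1(2)])
        show "\<forall>z\<in>D1. a \<le> Inf (snd z) \<and> Inf (snd z) \<le> Sup (snd z) \<and> Sup (snd z) \<le> b"
          using K1 by fastforce
        show disj: "disjoint_family_on (\<lambda>z. {Inf (snd z)<..<Sup (snd z)}) D1"
          unfolding disjoint_family_on_def
        proof (intro ballI impI)
          fix z w assume zw: "z \<in> D1" "w \<in> D1" "z \<noteq> w"
          obtain u v where uv: "snd z = {u..v}" "u \<le> v"
            using K1[OF zw(1)] by auto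
          obtain u' v' where uv': "snd w = {u'..v'}" "u' \<le> v'"
            using K1[OF zw(2)] by auto
          have "interior (snd z) \<inter> interior (snd w) = {}"
            using tagged_division_ofD(5)[OF D, of "fst z" "snd z" "fst w" "snd w"] zw D1(1)
            by (auto simp: prod_eq_iff)
          then show "{Inf (snd z)<..<Sup (snd z)} \<inter> {Inf (snd w)<..<Sup (snd w)} = {}"
            using uv uv' by simp
        qed
        have "(\<Sum>z\<in>D1. Sup (snd z) - Inf (snd z)) = (\<Sum>z\<in>D1. measure lebesgue {Inf (snd z)<..<Sup (snd z)})"
        proof (rule sum.cong)
          fix z assume "z \<in> D1"
          then show "Sup (snd z) - Inf (snd z) = measure lebesgue {Inf (snd z)<..<Sup (snd z)}"
            using K1[of z] by auto
        qed simp
        also have "\<dots> = measure lebesgue (\<Union>z\<in>D1. {Inf (snd z)<..<Sup (snd z)})"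
        proof (rule measure_finite_Union[symmetric, OF D1(2) _ disj])
          show "emeasure lebesgue {Inf (snd z)<..<Sup (snd z)} \<noteq> \<infinity>" if "z \<in> D1" for z
            using K1[OF that] by auto
        qed auto
        also have "\<dots> \<le> measure lebesgue U"
        proof (rule measure_mono_fmeasurable[OF _ _ Um])
          show "(\<Union>z\<in>D1. {Inf (snd z)<..<Sup (snd z)}) \<subseteq> U"
          proof (rule UN_least)
            fix z assume z: "z \<in> D1"
            then obtain x J where zx: "z = (x, J)" "x \<in> N" "(x, J) \<in> D"
              unfolding D1_def by auto
            then have "J \<subseteq> U"
              using fine unfolding fine_def \<gamma>_def by force
            moreover have "{Inf J<..<Sup J} \<subseteq> J"
              using K[OF zx(3)] by auto
            ultimately show "{Inf (snd z)<..<Sup (snd z)} \<subseteq> U"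
              using zx by auto
          qed
          show "(\<Union>z\<in>D1. {Inf (snd z)<..<Sup (snd z)}) \<in> sets lebesgue"
            using D1(2) by (intro sets.finite_UN) auto
        qed
        finally show "(\<Sum>z\<in>D1. Sup (snd z) - Inf (snd z)) < d"
          using mU by simp
      qed
      finally show ?thesis
        using s2 unfolding eq by simp
    qed
    ultimately show "\<exists>\<gamma>. gauge \<gamma> \<and> (\<forall>D. D tagged_division_of {a..b} \<and> \<gamma> fine D \<longrightarrow>
        norm ((\<Sum>(x, K)\<in>D. measure lborel K *\<^sub>R g' x) - (f b - f a)) < e)"
      by (intro exI[of _ \<gamma>]) simp
  qed
  then show ?thesis
    using has_integral_spike[OF negl, of "{a..b}" g g'] by (auto simp: g'_def)
qed

text \<open>The form in which the fundamental theorem is applied: an a.e. lower bound on the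
  derivative bounds the increment from below.\<close>

lemma abs_cont_on_ge_integral:
  assumes "abs_cont_on a b f" "a \<le> b"
    and der: "AE t in lebesgue. t \<in> {a..b} \<longrightarrow> (f has_real_derivative f' t) (at t)"
    and g: "(g has_integral I) {a..b}"
    and le: "AE t in lebesgue. t \<in> {a..b} \<longrightarrow> g t \<le> f' t"
  shows "I \<le> f b - f a"
proof -
  have f: "(f' has_integral (f b - f a)) {a..b}"
    using assms by (intro abs_cont_on_has_integral) (auto intro: has_field_derivative_at_within elim: eventually_mono)
  obtain N where N: "N \<in> null_sets lebesgue" "{t. \<not> (t \<in> {a..b} \<longrightarrow> g t \<le> f' t)} \<subseteq> N"
    using le unfolding eventually_ae_filter by auto
  \<comment> \<open>Replacing \<open>f'\<close> by \<open>g\<close> on a null set keeps the integral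
    and makes the comparison hold at every point.\<close>
  have "((\<lambda>t. if t \<in> N then g t else f' t) has_integral (f b - f a)) {a..b}"
    using N(1) by (intro has_integral_spike[OF _ _ f, of N]) (auto simp: negligible_iff_null_sets)
  then show ?thesis
    using N(2) by (intro has_integral_le[OF g]) auto
qed

lemma has_integral_real_derivative:
  fixes G :: "real \<Rightarrow> real"
  assumes "a \<le> b" "\<And>t. t \<in> {a..b} \<Longrightarrow> (G has_real_derivative g t) (at t within {a..b})"
  shows "(g has_integral (G b - G a)) {a..b}"
  using assms by (intro fundamental_theorem_of_calculus) (auto simp: has_real_derivative_iff_has_vector_derivative)

text \<open>One estimate of increments serves Lipschitz functions, sums, multiples and products
  alike.\<close>

lemma abs_cont_on_dominated:
  assumes f: "abs_cont_on a b f" and g: "abs_cont_on a b g"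
    and le: "\<And>u v. \<lbrakk>a \<le> u; u \<le> v; v \<le> b\<rbrakk> \<Longrightarrow> \<bar>h v - h u\<bar> \<le> B * (\<bar>f v - f u\<bar> + \<bar>g v - g u\<bar>)"
  shows "abs_cont_on a b h"
  unfolding abs_cont_on_def
proof (intro allI impI)
  fix \<epsilon> :: real assume "\<epsilon> > 0"
  \<comment> \<open>\<open>\<bar>B\<bar> + 1\<close> replaces \<open>B\<close>, which may be zero or
    negative, so that \<open>e\<close> is positive and the final inequality strict.\<close>
  define e where "e = \<epsilon> / (2 * (\<bar>B\<bar> + 1))"
  have "e > 0" using \<open>\<epsilon> > 0\<close> by (simp add: e_def)
  obtain d1 where "d1 > 0" and d1: "\<forall>(n::nat) u v.
     (\<forall>i<n. a \<le> u i \<and> u i \<le> v i \<and> v i \<le> b) \<and>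
     (\<forall>i<n. \<forall>j<n. i \<noteq> j \<longrightarrow> {u i<..<v i} \<inter> {u j<..<v j} = {}) \<and>
     (\<Sum>i<n. v i - u i) < d1 \<longrightarrow> (\<Sum>i<n. \<bar>f (v i) - f (u i)\<bar>) < e"
    using f[unfolded abs_cont_on_def, rule_format, OF \<open>e > 0\<close>] by (elim exE conjE)
  obtain d2 where "d2 > 0" and d2: "\<forall>(n::nat) u v.
     (\<forall>i<n. a \<le> u i \<and> u i \<le> v i \<and> v i \<le> b) \<and>
     (\<forall>i<n. \<forall>j<n. i \<noteq> j \<longrightarrow> {u i<..<v i} \<inter> {u j<..<v j} = {}) \<and>
     (\<Sum>i<n. v i - u i) < d2 \<longrightarrow> (\<Sum>i<n. \<bar>g (v i) - g (u i)\<bar>) < e"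
    using g[unfolded abs_cont_on_def, rule_format, OF \<open>e > 0\<close>] by (elim exE conjE)
  have "(\<Sum>i<n. \<bar>h (v i) - h (u i)\<bar>) < \<epsilon>"
    if uv: "\<forall>i<n. a \<le> u i \<and> u i \<le> v i \<and> v i \<le> b"
      and dj: "\<forall>i<n. \<forall>j<n. i \<noteq> j \<longrightarrow> {u i<..<v i} \<inter> {u j<..<v j} = {}"
      and len: "(\<Sum>i<n. v i - u i) < min d1 d2" for n :: nat and u v
  proof -
    have "(\<Sum>i<n. \<bar>f (v i) - f (u i)\<bar>) < e"
      by (rule d1[rule_format]) (use uv dj len in simp)
    moreover have "(\<Sum>i<n. \<bar>g (v i) - g (u i)\<bar>) < e"
      by (rule d2[rule_format]) (use uv dj len in simp)
    ultimately have s: "(\<Sum>i<n. \<bar>f (v i) - f (u i)\<bar> + \<bar>g (v i) - g (u i)\<bar>) < 2 * e"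
      by (simp add: sum.distrib)
    have "(\<Sum>i<n. \<bar>h (v i) - h (u i)\<bar>) \<le> (\<Sum>i<n. (\<bar>B\<bar> + 1) * (\<bar>f (v i) - f (u i)\<bar> + \<bar>g (v i) - g (u i)\<bar>))"
    proof (rule sum_mono)
      fix i assume "i \<in> {..<n}"
      then have "\<bar>h (v i) - h (u i)\<bar> \<le> B * (\<bar>f (v i) - f (u i)\<bar> + \<bar>g (v i) - g (u i)\<bar>)"
        using uv by (intro le) auto
      also have "\<dots> \<le> (\<bar>B\<bar> + 1) * (\<bar>f (v i) - f (u i)\<bar> + \<bar>g (v i) - g (u i)\<bar>)"
        by (intro mult_right_mono) auto
      finally show "\<bar>h (v i) - h (u i)\<bar> \<le> (\<bar>B\<bar> + 1) * (\<bar>f (v i) - f (u i)\<bar> + \<bar>g (v i) - g (u i)\<bar>)" .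
    qed
    also have "\<dots> < (\<bar>B\<bar> + 1) * (2 * e)"
      unfolding sum_distrib_left[symmetric] using s by (intro mult_strict_left_mono) auto
    also have "\<dots> = \<epsilon>"
      by (simp add: e_def field_simps add_nonneg_eq_0_iff)
    finally show ?thesis .
  qed
  with \<open>d1 > 0\<close> \<open>d2 > 0\<close> show "\<exists>\<delta>>0. \<forall>(n::nat) u v.
     (\<forall>i<n. a \<le> u i \<and> u i \<le> v i \<and> v i \<le> b) \<and>
     (\<forall>i<n. \<forall>j<n. i \<noteq> j \<longrightarrow> {u i<..<v i} \<inter> {u j<..<v j} = {}) \<and>
     (\<Sum>i<n. v i - u i) < \<delta> \<longrightarrow> (\<Sum>i<n. \<bar>h (v i) - h (u i)\<bar>) < \<epsilon>"
    by (intro exI[of _ "min d1 d2"]) simp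
qed

section \<open>Examples and closure rules for absolute continuity\<close>

lemma abs_cont_on_id: "abs_cont_on a b (\<lambda>t. t)"
  unfolding abs_cont_on_def
proof (intro allI impI)
  fix \<epsilon> :: real assume "\<epsilon> > 0"
  have "(\<Sum>i<n. \<bar>v i - u i\<bar>) = (\<Sum>i<n. v i - u i)"
    if "\<forall>i<n. a \<le> u i \<and> u i \<le> v i \<and> v i \<le> b" for n :: nat and u v
    using that by (intro sum.cong) auto
  with \<open>\<epsilon> > 0\<close> show "\<exists>\<delta>>0. \<forall>(n::nat) u v.
     (\<forall>i<n. a \<le> u i \<and> u i \<le> v i \<and> v i \<le> b) \<and>
     (\<forall>i<n. \<forall>j<n. i \<noteq> j \<longrightarrow> {u i<..<v i} \<inter> {u j<..<v j} = {}) \<and>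
     (\<Sum>i<n. v i - u i) < \<delta> \<longrightarrow> (\<Sum>i<n. \<bar>v i - u i\<bar>) < \<epsilon>"
    by (intro exI[of _ \<epsilon>]) auto
qed

lemma abs_cont_on_lipschitz:
  assumes "\<And>u v. \<lbrakk>a \<le> u; u \<le> v; v \<le> b\<rbrakk> \<Longrightarrow> \<bar>h v - h u\<bar> \<le> B * (v - u)"
  shows "abs_cont_on a b h"
proof (rule abs_cont_on_dominated[OF abs_cont_on_id abs_cont_on_id, where B = "B/2"])
  fix u v assume "a \<le> u" "u \<le> v" "v \<le> b"
  then show "\<bar>h v - h u\<bar> \<le> B / 2 * (\<bar>v - u\<bar> + \<bar>v - u\<bar>)"
    using assms[of u v] by (simp add: algebra_simps)
qed

lemma abs_cont_on_C1:
  fixes h :: "real \<Rightarrow> real"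
  assumes der: "\<And>t. t \<in> {a..b} \<Longrightarrow> (h has_real_derivative h' t) (at t within {a..b})"
    and cont: "continuous_on {a..b} h'"
  shows "abs_cont_on a b h"
proof -
  obtain B where B: "\<And>t. t \<in> {a..b} \<Longrightarrow> \<bar>h' t\<bar> \<le> B"
    using compact_imp_bounded[OF compact_continuous_image[OF cont compact_Icc]]
    unfolding bounded_iff by (metis image_eqI real_norm_def)
  show ?thesis
  proof (rule abs_cont_on_lipschitz[where B = B])
    fix u v assume uv: "a \<le> u" "u \<le> v" "v \<le> b"
    have "norm (h v - h u) \<le> B * norm (v - u)"
      by (rule field_differentiable_bound[of "{a..b}" h h']) (use der B uv in auto)
    then show "\<bar>h v - h u\<bar> \<le> B * (v - u)" using uv by simp
  qed
qed

lemma abs_cont_on_add: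
  "\<lbrakk>abs_cont_on a b f; abs_cont_on a b g\<rbrakk> \<Longrightarrow> abs_cont_on a b (\<lambda>t. f t + g t)"
  by (rule abs_cont_on_dominated[where f = f and g = g and B = 1]) auto

lemma abs_cont_on_cmult: "abs_cont_on a b f \<Longrightarrow> abs_cont_on a b (\<lambda>t. c * f t)"
  by (rule abs_cont_on_dominated[where f = f and g = f and B = "\<bar>c\<bar>"])
     (auto simp: abs_mult right_diff_distrib[symmetric] mult_left_mono)

lemma abs_cont_on_subset: "\<lbrakk>abs_cont_on a b f; a \<le> a'; b' \<le> b\<rbrakk> \<Longrightarrow> abs_cont_on a' b' f"
  unfolding abs_cont_on_def
  by (elim all_forward imp_forward ex_forward conj_forward) (auto intro: order_trans)

lemma abs_cont_on_imp_continuous_on: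
  assumes "abs_cont_on a b f"
  shows "continuous_on {a..b} f"
  unfolding continuous_on_iff
proof (intro ballI allI impI)
  fix t \<epsilon> :: real assume t: "t \<in> {a..b}" and "\<epsilon> > 0"
  obtain d where "d > 0" and *: "\<forall>(n::nat) u v. (\<forall>i<n. a \<le> u i \<and> u i \<le> v i \<and> v i \<le> b) \<and>
     (\<forall>i<n. \<forall>j<n. i \<noteq> j \<longrightarrow> {u i<..<v i} \<inter> {u j<..<v j} = {}) \<and>
     (\<Sum>i<n. v i - u i) < d \<longrightarrow> (\<Sum>i<n. \<bar>f (v i) - f (u i)\<bar>) < \<epsilon>"
    using assms[unfolded abs_cont_on_def, rule_format, OF \<open>\<epsilon> > 0\<close>] by (elim exE conjE)
  have "dist (f r) (f t) < \<epsilon>" if r: "r \<in> {a..b}" "dist r t < d" for r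
  proof -
    \<comment> \<open>A family of one interval; \<open>min\<close> and \<open>max\<close> order its
      end points, so \<open>r\<close> may lie on either side of \<open>t\<close>.\<close>
    have "(\<Sum>i<1::nat. \<bar>f ((\<lambda>_. max r t) i) - f ((\<lambda>_. min r t) i)\<bar>) < \<epsilon>"
      by (rule *[rule_format]) (use r t in \<open>auto simp: dist_real_def max_def min_def\<close>)
    then show ?thesis
      by (auto simp: dist_real_def max_def min_def abs_minus_commute split: if_splits)
  qed
  with \<open>d > 0\<close> show "\<exists>d>0. \<forall>r\<in>{a..b}. dist r t < d \<longrightarrow> dist (f r) (f t) < \<epsilon>"
    by blast
qed

lemma abs_cont_on_mult:
  assumes f: "abs_cont_on a b f" and g: "abs_cont_on a b g"
  shows "abs_cont_on a b (\<lambda>t. f t * g t)"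
proof -
  have "\<exists>B. \<forall>t\<in>{a..b}. \<bar>h t\<bar> \<le> B" if "abs_cont_on a b h" for h
    using compact_imp_bounded[OF compact_continuous_image[OF abs_cont_on_imp_continuous_on[OF that] compact_Icc]]
    unfolding bounded_iff by auto
  then obtain A B where A: "\<And>t. t \<in> {a..b} \<Longrightarrow> \<bar>f t\<bar> \<le> A" and B: "\<And>t. t \<in> {a..b} \<Longrightarrow> \<bar>g t\<bar> \<le> B"
    using f g by meson
  show ?thesis
  proof (rule abs_cont_on_dominated[OF f g, where B = "max A B"])
    fix u v assume uv: "a \<le> u" "u \<le> v" "v \<le> b"
    have "f v * g v - f u * g u = g u * (f v - f u) + f v * (g v - g u)"
      by (simp add: algebra_simps)
    then have "\<bar>f v * g v - f u * g u\<bar> \<le> \<bar>g u\<bar> * \<bar>f v - f u\<bar> + \<bar>f v\<bar> * \<bar>g v - g u\<bar>"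
      by (metis abs_mult abs_triangle_ineq)
    also have "\<dots> \<le> max A B * \<bar>f v - f u\<bar> + max A B * \<bar>g v - g u\<bar>"
      using A[of v] B[of u] uv by (intro add_mono mult_right_mono) auto
    finally show "\<bar>f v * g v - f u * g u\<bar> \<le> max A B * (\<bar>f v - f u\<bar> + \<bar>g v - g u\<bar>)"
      by (simp add: distrib_left)
  qed
qed

text \<open>The a.e. bound becomes pointwise after changing \<open>G\<close> to
  \<open>\<bar>F\<bar>\<close> on a null set, which affects no integral.\<close>

lemma integrable_on_if_AE_le:
  fixes F G :: "real \<Rightarrow> real"
  assumes F: "F \<in> borel_measurable lebesgue" and G: "G integrable_on {a..b}"
    and le: "AE t in lebesgue. t \<in> {a..b} \<longrightarrow> \<bar>F t\<bar> \<le> G t"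
  shows "F integrable_on {a..b}" and "\<bar>integral {a..b} F\<bar> \<le> integral {a..b} G"
proof -
  obtain N where N: "N \<in> null_sets lebesgue" "{t. \<not> (t \<in> {a..b} \<longrightarrow> \<bar>F t\<bar> \<le> G t)} \<subseteq> N"
    using le unfolding eventually_ae_filter by auto
  define G' where "G' = (\<lambda>t. if t \<in> N then \<bar>F t\<bar> else G t)"
  have negl: "negligible N"
    using N by (simp add: negligible_iff_null_sets)
  have G': "G' integrable_on {a..b}" "integral {a..b} G' = integral {a..b} G"
    using integrable_spike[OF G negl, of G'] integral_spike[OF negl, of "{a..b}" G G']
    by (auto simp: G'_def)
  have le': "norm (F t) \<le> G' t" if "t \<in> {a..b}" for t
    using N(2) that by (auto simp: G'_def)
  show F': "F integrable_on {a..b}"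
    by (rule measurable_bounded_by_integrable_imp_integrable[OF _ G'(1) le'])
       (use F in \<open>auto intro: measurable_restrict_space1\<close>)
  show "\<bar>integral {a..b} F\<bar> \<le> integral {a..b} G"
    using integral_norm_bound_integral[OF F' G'(1) le'] G'(2) by simp
qed

text \<open>Lebesgue differentiation. \<open>integrable_ccontinuous_explicit\<close> handles
  averages to the right of a point; averages to the left are right-hand averages of the reflected
  integrand, whose exceptional set is then reflected back.\<close>

theorem AE_integral_has_real_derivative:
  fixes F :: "real \<Rightarrow> real"
  assumes int: "\<And>a b. F integrable_on {a..b}"
  shows "AE t in lebesgue. t > s \<longrightarrow> ((\<lambda>v. integral {s..v} F) has_real_derivative F t) (at t)"
proof -
  obtain N1 where N1: "negligible N1" "\<And>x e. \<lbrakk>x \<notin> N1; 0 < e\<rbrakk> \<Longrightarrow> \<exists>d>0. \<forall>h. 0 < h \<and> h < d \<longrightarrow>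
      norm (integral (cbox x (x + h *\<^sub>R One)) F /\<^sub>R h ^ DIM(real) - F x) < e"
    using integrable_ccontinuous_explicit[of F] int by (metis box_real(2))
  have "(\<lambda>x. F (- x)) integrable_on cbox a b" for a b
    using int[of "-b" "-a"] Henstock_Kurzweil_Integration.integrable_reflect_real[of F "-a" "-b"] by simp
  then obtain N2 where N2: "negligible N2" "\<And>x e. \<lbrakk>x \<notin> N2; 0 < e\<rbrakk> \<Longrightarrow> \<exists>d>0. \<forall>h. 0 < h \<and> h < d \<longrightarrow>
      norm (integral (cbox x (x + h *\<^sub>R One)) (\<lambda>x. F (- x)) /\<^sub>R h ^ DIM(real) - F (- x)) < e"
    using integrable_ccontinuous_explicit[of "\<lambda>x. F (- x)"] by metis
  have "negligible (uminus ` N2)"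
    using N2(1) by (intro negligible_differentiable_image_negligible) (auto simp: differentiable_on_def intro!: derivative_intros)
  then have N: "N1 \<union> uminus ` N2 \<in> null_sets lebesgue"
    using N1(1) negligible_iff_null_sets negligible_Un by blast
  show ?thesis
  proof (rule AE_I'[OF N], rule subsetI, rule ccontr)
    fix t assume "t \<in> {t \<in> space lebesgue. \<not> (s < t \<longrightarrow> ((\<lambda>v. integral {s..v} F) has_real_derivative F t) (at t))}"
      and tN: "t \<notin> N1 \<union> uminus ` N2"
    then have nd: "\<not> ((\<lambda>v. integral {s..v} F) has_real_derivative F t) (at t)" and "s < t"
      by auto
    from tN have t: "t \<notin> N1" "- t \<notin> N2" by force+
    have "((\<lambda>v. integral {s..v} F) has_real_derivative F t) (at t)"
      unfolding DERIV_def
    proof (rule LIM_I)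
      fix e :: real assume "e > 0"
      obtain d1 where "d1 > 0" and d1: "\<And>h. \<lbrakk>0 < h; h < d1\<rbrakk> \<Longrightarrow> \<bar>integral {t..t + h} F / h - F t\<bar> < e"
        using N1(2)[OF t(1) \<open>e > 0\<close>] by (auto simp: divide_inverse mult.commute)
      obtain d2 where "d2 > 0" and d2: "\<And>h. \<lbrakk>0 < h; h < d2\<rbrakk> \<Longrightarrow> \<bar>integral {- t..- t + h} (\<lambda>x. F (- x)) / h - F t\<bar> < e"
        using N2(2)[OF t(2) \<open>e > 0\<close>] by (auto simp: divide_inverse mult.commute)
      have "\<bar>(integral {s..t + h} F - integral {s..t} F) / h - F t\<bar> < e"
        if h: "h \<noteq> 0" "\<bar>h\<bar> < min (min d1 d2) (t - s)" for h
      proof (cases "h > 0")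
        case True
        have "integral {s..t} F + integral {t..t + h} F = integral {s..t + h} F"
          using True \<open>s < t\<close> by (intro Henstock_Kurzweil_Integration.integral_combine int) auto
        then have "integral {s..t + h} F - integral {s..t} F = integral {t..t + h} F"
          by linarith
        then show ?thesis
          using d1[of h] True h by simp
      next
        case False
        have "integral {s..t + h} F + integral {t + h..t} F = integral {s..t} F"
          using False \<open>s < t\<close> h by (intro Henstock_Kurzweil_Integration.integral_combine int) auto
        moreover have "integral {- t..- t + - h} (\<lambda>x. F (- x)) = integral {t + h..t} F"
          using Henstock_Kurzweil_Integration.integral_reflect_real[of t "t + h" F] by simp
        ultimately have "integral {s..t + h} F - integral {s..t} F = - integral {- t..- t + - h} (\<lambda>x. F (- x))"
          by linarith
        then show ?thesis
          using d2[of "- h"] False h by simp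
      qed
      then show "\<exists>r>0. \<forall>h. h \<noteq> 0 \<and> norm (h - 0) < r \<longrightarrow>
          norm ((integral {s..t + h} F - integral {s..t} F) / h - F t) < e"
        using \<open>d1 > 0\<close> \<open>d2 > 0\<close> \<open>s < t\<close> by (intro exI[of _ "min (min d1 d2) (t - s)"]) simp
    qed
    with nd show False by blast
  qed
qed

subsection \<open>Nonoscillatory solutions\<close>

text \<open>The zeros in \<open>{c..b}\<close> form a compact set, and the intermediate value
  theorem forbids a nonpositive value before its least element.\<close>

lemma first_zero_after:
  fixes f :: "real \<Rightarrow> real"
  assumes "continuous_on {c..b} f" "c \<le> b" "f c > 0" "f b \<le> 0"
  obtains z where "c < z" "z \<le> b" "f z = 0" "\<And>t. \<lbrakk>c \<le> t; t < z\<rbrakk> \<Longrightarrow> f t > 0"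
proof -
  define S where "S = {c..b} \<inter> f -` {0}"
  have "compact S"
    unfolding S_def using continuous_closed_preimage[OF assms(1) closed_atLeastAtMost closed_singleton, of 0]
    by (metis compact_Icc compact_Int_closed inf.left_idem)
  moreover have "S \<noteq> {}"
    using IVT2'[of f b 0 c] assms by (auto simp: S_def)
  ultimately obtain z where z: "z \<in> S" "\<And>t. t \<in> S \<Longrightarrow> z \<le> t"
    using compact_attains_inf by metis
  have pos: "f t > 0" if t: "c \<le> t" "t < z" for t
  proof (rule ccontr)
    assume "\<not> f t > 0"
    moreover have "continuous_on {c..t} f"
      using t z(1) by (intro continuous_on_subset[OF assms(1)]) (auto simp: S_def)
    ultimately obtain r where "c \<le> r" "r \<le> t" "f r = 0"
      using IVT2'[of f t 0 c] t(1) assms(3) by (auto simp: not_less)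
    then show False
      using z t by (force simp: S_def)
  qed
  show thesis
    using z(1) assms(3) by (intro that[of z] pos) (auto simp: S_def less_le)
qed

lemma last_zero_before:
  fixes f :: "real \<Rightarrow> real"
  assumes "continuous_on {b..c} f" "b \<le> c" "f c > 0" "f b \<le> 0"
  obtains z where "b \<le> z" "z < c" "f z = 0" "\<And>t. \<lbrakk>z < t; t \<le> c\<rbrakk> \<Longrightarrow> f t > 0"
proof -
  have "continuous_on {-c..-b} (\<lambda>t. f (- t))"
    by (rule continuous_on_compose2[OF assms(1)]) (auto intro!: continuous_intros)
  then obtain z where z: "- c < z" "z \<le> - b" "f (- z) = 0" "\<And>t. \<lbrakk>- c \<le> t; t < z\<rbrakk> \<Longrightarrow> f (- t) > 0"
    using first_zero_after[of "-c" "-b" "\<lambda>t. f (- t)"] assms by auto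
  show thesis
    using z(1-3) z(4)[of "- t" for t] by (intro that[of "- z"]) auto
qed

section \<open>The equation as a first-order system, and its elementary comparison
  principles\<close>

locale delay_equation =
  fixes q \<tau> :: "real \<Rightarrow> real" and s h P :: real
  assumes q_measurable: "q \<in> borel_measurable lebesgue"
    and tau_measurable: "\<tau> \<in> borel_measurable lebesgue"
    and q_nonneg: "\<And>t. 0 \<le> q t"
    and q_le: "AE t in lebesgue. q t \<le> P"
    and P_pos: "0 < P"
    and tau_nonneg: "\<And>t. 0 \<le> \<tau> t"
    and tau_le: "AE t in lebesgue. t \<ge> s \<longrightarrow> \<tau> t \<le> h"
    and h_nonneg: "0 \<le> h"
    and q_integral_unbounded: "\<And>C T. \<exists>b\<ge>T. C \<le> integral {T..b} q"
begin

text \<open>The derivative \<open>y\<close> is carried explicitly, so that a.e. statements concern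
  \<open>y\<close> alone. Absolute continuity of \<open>x\<close> is recovered by
  \<open>abs_cont_on_C1\<close>, because \<open>y\<close> is continuous.\<close>

definition solves :: "(real \<Rightarrow> real) \<Rightarrow> (real \<Rightarrow> real) \<Rightarrow> bool" where
  "solves x y \<longleftrightarrow>
     (\<forall>t\<ge>s - h. (x has_real_derivative y t) (at t within {s - h..})) \<and>
     loc_abs_cont_from (s - h) y \<and>
     (AE t in lebesgue. t \<ge> s \<longrightarrow> (y has_real_derivative q t * x (t - \<tau> t)) (at t))"

lemma solves_has_derivative:
  assumes "solves x y" "t > s - h"
  shows "(x has_real_derivative y t) (at t)"
proof -
  have "(x has_real_derivative y t) (at t within {s - h..})"
    using assms by (auto simp: solves_def)
  moreover have "at t within {s - h..} = at t"
    using assms(2) by (intro at_within_interior) (auto simp: interior_real_atLeast)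
  ultimately show ?thesis by simp
qed

lemma solves_continuous:
  assumes "solves x y" "s - h \<le> a"
  shows "continuous_on {a..b} x"
proof -
  have "continuous_on {s - h..} x"
    using assms(1) unfolding solves_def by (auto intro: DERIV_continuous_on)
  then show ?thesis
    by (rule continuous_on_subset) (use assms(2) in auto)
qed

lemma solves_abs_cont: "\<lbrakk>solves x y; s - h \<le> a\<rbrakk> \<Longrightarrow> abs_cont_on a b y"
  unfolding solves_def loc_abs_cont_from_def
  by (cases "s - h \<le> b") (auto intro: abs_cont_on_subset simp: abs_cont_on_subset[where b = a])

lemma solves_lincomb:
  assumes "solves x y" "solves x' y'"
  shows "solves (\<lambda>t. c * x t + d * x' t) (\<lambda>t. c * y t + d * y' t)"
proof -
  have "AE t in lebesgue. t \<ge> s \<longrightarrow> ((\<lambda>t. c * y t + d * y' t) has_real_derivative q t * (c * x (t - \<tau> t) + d * x' (t - \<tau> t))) (at t)"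
    using assms unfolding solves_def
    by (auto elim!: eventually_elim2 intro!: derivative_eq_intros simp: algebra_simps)
  then show ?thesis
    using assms unfolding solves_def loc_abs_cont_from_def
    by (auto intro!: DERIV_add DERIV_cmult abs_cont_on_add abs_cont_on_cmult)
qed

lemma solves_uminus: "solves x y \<Longrightarrow> solves (\<lambda>t. - x t) (\<lambda>t. - y t)"
  using solves_lincomb[of x y x y "-1" 0] by simp

lemma solves_ge_integral:
  assumes sol: "solves x y" and "s \<le> a" "a \<le> b" and g: "(g has_integral I) {a..b}"
    and le: "AE t in lebesgue. t \<in> {a..b} \<longrightarrow> g t \<le> q t * x (t - \<tau> t)"
  shows "I \<le> y b - y a"
proof (rule abs_cont_on_ge_integral[OF _ \<open>a \<le> b\<close> _ g le])
  show "abs_cont_on a b y"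
    using assms h_nonneg by (intro solves_abs_cont[OF sol]) auto
  show "AE t in lebesgue. t \<in> {a..b} \<longrightarrow> (y has_real_derivative q t * x (t - \<tau> t)) (at t)"
    using sol \<open>s \<le> a\<close> unfolding solves_def by (auto elim: eventually_mono)
qed

lemma solves_fst_ge_integral:
  assumes sol: "solves x y" and "s - h \<le> a" "a \<le> b" and g: "(g has_integral I) {a..b}"
    and le: "\<And>t. t \<in> {a..b} \<Longrightarrow> g t \<le> y t"
  shows "I \<le> x b - x a"
proof (rule has_integral_le[OF g has_integral_real_derivative le])
  show "(x has_real_derivative y t) (at t within {a..b})" if "t \<in> {a..b}" for t
    using sol that \<open>s - h \<le> a\<close> unfolding solves_def
    by (auto intro!: has_field_derivative_subset[of x "y t" t "{s - h..}" "{a..b}"])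
qed (use assms in auto)

lemma solves_fst_le_integral:
  assumes sol: "solves x y" and "s - h \<le> a" "a \<le> b" and g: "(g has_integral I) {a..b}"
    and le: "\<And>t. t \<in> {a..b} \<Longrightarrow> y t \<le> g t"
  shows "x b - x a \<le> I"
  using solves_fst_ge_integral[OF solves_uminus[OF sol] assms(2,3) has_integral_neg[OF g]] le by simp

text \<open>Convexity: nonnegative delayed values force \<open>x'' \<ge> 0\<close> a.e. The sign
  condition starts at \<open>a - h\<close> because delayed arguments reach back that far.\<close>

lemma solves_snd_mono:
  assumes sol: "solves x y" and "s \<le> a" "a \<le> b"
    and nonneg: "\<And>t. \<lbrakk>a - h \<le> t; t \<le> b\<rbrakk> \<Longrightarrow> 0 \<le> x t"
  shows "y a \<le> y b"
proof -
  have "AE t in lebesgue. t \<in> {a..b} \<longrightarrow> 0 \<le> q t * x (t - \<tau> t)"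
    using tau_le
  proof eventually_elim
    case (elim t)
    then show ?case
      using \<open>s \<le> a\<close> tau_nonneg[of t] q_nonneg[of t] nonneg[of "t - \<tau> t"] by auto
  qed
  from solves_ge_integral[OF sol assms(2,3) _ this, of 0] show ?thesis by simp
qed

lemma solves_mono:
  assumes sol: "solves x y" and "s - h \<le> a" "a \<le> b" and "\<And>t. t \<in> {a..b} \<Longrightarrow> 0 \<le> y t"
  shows "x a \<le> x b"
  using solves_fst_ge_integral[OF sol assms(2,3) has_integral_0] assms(4) by simp

lemma solves_antimono:
  assumes sol: "solves x y" and "s - h \<le> a" "a \<le> b" and "\<And>t. t \<in> {a..b} \<Longrightarrow> y t \<le> 0"
  shows "x b \<le> x a"
  using solves_mono[OF solves_uminus[OF sol] assms(2,3)] assms(4) by simp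

text \<open>Up to a first zero \<open>z\<close> the solution would be convex with
  \<open>0 \<le> y c\<close>, hence nondecreasing, contradicting \<open>x z = 0 < x c\<close>. This
  forces zeros near the extrema of oscillatory solutions, and makes growth stable in the shooting
  argument.\<close>

lemma solves_stays_positive:
  assumes sol: "solves x y" and "s \<le> c" and pos: "\<And>t. \<lbrakk>c - h \<le> t; t \<le> c\<rbrakk> \<Longrightarrow> 0 < x t"
    and "0 \<le> y c" and "c \<le> t"
  shows "0 < x t"
proof (rule ccontr)
  assume neg: "\<not> 0 < x t"
  have "x c > 0" using pos[of c] h_nonneg by simp
  have cont: "continuous_on {c..t} x"
    using assms h_nonneg by (intro solves_continuous[OF sol]) auto
  have "x t \<le> 0" using neg by simp
  then obtain z where z: "c < z" "z \<le> t" "x z = 0" "\<And>r. \<lbrakk>c \<le> r; r < z\<rbrakk> \<Longrightarrow> x r > 0"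
    using first_zero_after[OF cont \<open>c \<le> t\<close> \<open>x c > 0\<close>] by blast
  have "0 \<le> x r" if "c - h \<le> r" "r \<le> z" for r
    using that pos[of r] z(3) z(4)[of r] by (cases "r \<le> c"; cases "r = z") auto
  then have "0 \<le> y r" if "r \<in> {c..z}" for r
    using solves_snd_mono[OF sol \<open>s \<le> c\<close>, of r] that \<open>0 \<le> y c\<close> by force
  then have "x c \<le> x z"
    using \<open>s \<le> c\<close> h_nonneg z(1) by (intro solves_mono[OF sol]) auto
  then show False using z(3) \<open>x c > 0\<close> by simp
qed

lemma q_integrable: "q integrable_on {a..b}"
  using q_le q_nonneg by (intro integrable_on_if_AE_le(1)[OF q_measurable integrable_const_ivl[of P]])
    (auto elim: eventually_mono)

lemma solves_deriv_ge_q_integral: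
  assumes sol: "solves x y" and "s \<le> T" "T \<le> b" and "0 \<le> L"
    and ge: "\<And>t. T - h \<le> t \<Longrightarrow> L \<le> x t"
  shows "L * integral {T..b} q \<le> y b - y T"
proof (rule solves_ge_integral[OF sol assms(2,3)])
  show "((\<lambda>t. L * q t) has_integral L * integral {T..b} q) {T..b}"
    using q_integrable integrable_integral by (intro has_integral_mult_right) blast
  show "AE t in lebesgue. t \<in> {T..b} \<longrightarrow> L * q t \<le> q t * x (t - \<tau> t)"
    using tau_le
  proof eventually_elim
    case (elim t)
    then show ?case
      using \<open>s \<le> T\<close> ge[of "t - \<tau> t"] q_nonneg[of t] by (auto simp: mult.commute[of L] intro!: mult_left_mono)
  qed
qed

lemma eventually_deriv_eq: "solves x y \<Longrightarrow> \<forall>\<^sub>F t in at_top. y t = deriv x t"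
  using eventually_gt_at_top[of "s - h"]
  by eventually_elim (metis DERIV_imp_deriv solves_has_derivative)

text \<open>By convexity \<open>y\<close> is nondecreasing from \<open>c\<close> on. If it becomes
  positive, \<open>x\<close> grows at least linearly and its positive lower bound drives
  \<open>y\<close> to infinity. Otherwise \<open>x\<close> decreases; a limit of \<open>y\<close>
  below 0 would make \<open>x\<close> negative, and a positive limit of \<open>x\<close> would make
  \<open>y\<close> positive.\<close>

theorem eventually_positive_solution_behaviour:
  assumes sol: "solves x y" and pos: "\<And>t. T0 \<le> t \<Longrightarrow> 0 < x t"
  shows "exhibits x Monotone_Decay \<or> exhibits x To_Plus_Infinity"
proof -
  \<comment> \<open>The shift by \<open>h\<close> keeps the delayed arguments beyond
    \<open>T0\<close>.\<close>
  define c where "c = max T0 s + h"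
  have c: "s \<le> c" "T0 \<le> c - h" "s - h \<le> c"
    using h_nonneg by (auto simp: c_def)
  have y_mono: "y a \<le> y b" if "c \<le> a" "a \<le> b" for a b
    using that c by (intro solves_snd_mono[OF sol] less_imp_le[OF pos]) auto
  have nonosc: "\<not> oscillatory x"
    using pos unfolding oscillatory_def by (metis less_irrefl)
  show ?thesis
  proof (cases "\<exists>t1\<ge>c. y t1 > 0")
    case True
    then obtain t1 where t1: "c \<le> t1" "y t1 > 0" by blast
    have x_ge: "x t1 + y t1 * (t - t1) \<le> x t" if "t1 \<le> t" for t
    proof -
      have "((\<lambda>_. y t1) has_integral y t1 * (t - t1)) {t1..t}"
        using has_integral_const_real[of "y t1" t1 t] that by (simp add: mult.commute)
      from solves_fst_ge_integral[OF sol _ that this] show ?thesis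
        using y_mono t1 c by auto
    qed
    have "filterlim (\<lambda>t. x t1 + y t1 * (t - t1)) at_top at_top"
      using t1 by (intro filterlim_tendsto_add_at_top[OF tendsto_const] filterlim_tendsto_pos_mult_at_top[OF tendsto_const])
        (auto intro: filterlim_tendsto_add_at_top[of "\<lambda>_. - t1", OF tendsto_const filterlim_ident, simplified])
    then have x_lim: "filterlim x at_top at_top"
      by (rule filterlim_at_top_mono) (auto intro: eventually_at_top_linorderI x_ge)
    have "filterlim y at_top at_top"
      unfolding filterlim_at_top
    proof
      fix Z
      have "x t1 > 0" using pos[of t1] t1 c h_nonneg by auto
      obtain b where b: "t1 + h \<le> b" "(Z - y (t1 + h)) / x t1 \<le> integral {t1 + h..b} q"
        using q_integral_unbounded by blast
      have "x t1 \<le> x t" if "t1 \<le> t" for t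
        using x_ge[OF that] t1 that by (smt (verit) mult_nonneg_nonneg)
      then have "x t1 * integral {t1 + h..b} q \<le> y b - y (t1 + h)"
        using c t1 b \<open>x t1 > 0\<close> h_nonneg by (intro solves_deriv_ge_q_integral[OF sol]) auto
      then have "Z \<le> y b"
        using b(2) \<open>x t1 > 0\<close> by (simp add: field_simps)
      then show "\<forall>\<^sub>F t in at_top. Z \<le> y t"
        using y_mono[of b] b(1) t1 h_nonneg by (intro eventually_at_top_linorderI[of b]) force
    qed
    then have "filterlim (deriv x) at_top at_top"
      using filterlim_cong[OF refl refl eventually_deriv_eq[OF sol]] by simp
    with x_lim show ?thesis by simp
  next
    case False
    then have y_nonpos: "y t \<le> 0" if "c \<le> t" for t
      using that by (meson not_le)
    have x_anti: "x b \<le> x a" if "c \<le> a" "a \<le> b" for a b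
      using that c y_nonpos by (intro solves_antimono[OF sol]) auto
    have "(y \<longlongrightarrow> 0) at_top"
      unfolding tendsto_iff
    proof (intro allI impI)
      fix e :: real assume "e > 0"
      have "\<exists>t\<ge>c. y t > - e"
      proof (rule ccontr)
        assume "\<not> (\<exists>t\<ge>c. y t > - e)"
        then have le: "y t \<le> - e" if "c \<le> t" for t using that by (meson not_le)
        \<comment> \<open>The line of slope \<open>- e\<close> through the point of the graph at
          \<open>c\<close> reaches 0 at \<open>b\<close>.\<close>
        define b where "b = c + x c / e"
        have "x c > 0" using pos[of c] c h_nonneg by auto
        then have "c \<le> b" using \<open>e > 0\<close> by (simp add: b_def)
        have "((\<lambda>_. - e) has_integral - e * (b - c)) {c..b}"
          using has_integral_const_real[of "- e" c b] \<open>c \<le> b\<close> by (simp add: mult.commute)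
        from solves_fst_le_integral[OF sol c(3) \<open>c \<le> b\<close> this] le have "x b \<le> 0"
          using \<open>e > 0\<close> by (auto simp: b_def)
        then show False
          using pos[of b] c \<open>c \<le> b\<close> h_nonneg by auto
      qed
      then obtain t where "c \<le> t" "y t > - e" by blast
      then have "dist (y r) 0 < e" if "t \<le> r" for r
        using y_mono[of t r] y_nonpos[of r] that by (auto simp: dist_real_def)
      then show "\<forall>\<^sub>F r in at_top. dist (y r) 0 < e"
        by (rule eventually_at_top_linorderI)
    qed
    then have y_lim: "(deriv x \<longlongrightarrow> 0) at_top"
      using filterlim_cong[OF refl refl eventually_deriv_eq[OF sol]] by simp
    have "(x \<longlongrightarrow> 0) at_top"
      unfolding tendsto_iff
    proof (intro allI impI)
      fix e :: real assume "e > 0"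
      have "\<exists>t\<ge>c. x t < e"
      proof (rule ccontr)
        assume "\<not> (\<exists>t\<ge>c. x t < e)"
        then have ge: "e \<le> x t" if "c \<le> t" for t using that by (meson not_le)
        \<comment> \<open>The integral is taken large enough to push \<open>y b\<close> up to 1,
          against \<open>y \<le> 0\<close>.\<close>
        obtain b where b: "c + h \<le> b" "(1 - y (c + h)) / e \<le> integral {c + h..b} q"
          using q_integral_unbounded by blast
        have "e * integral {c + h..b} q \<le> y b - y (c + h)"
          using c b \<open>e > 0\<close> h_nonneg ge by (intro solves_deriv_ge_q_integral[OF sol]) auto
        then have "1 \<le> y b"
          using b(2) \<open>e > 0\<close> by (simp add: field_simps)
        then show False
          using y_nonpos[of b] b(1) h_nonneg by simp
      qed
      then obtain t where "c \<le> t" "x t < e" by blast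
      then have "dist (x r) 0 < e" if "t \<le> r" for r
        using x_anti[of t r] pos[of r] that c h_nonneg by (auto simp: dist_real_def)
      then show "\<forall>\<^sub>F r in at_top. dist (x r) 0 < e"
        by (rule eventually_at_top_linorderI)
    qed
    moreover have "eventually_monotone x"
      using x_anti unfolding eventually_monotone_def
      by (intro exI[of _ c] disjI2) (auto intro!: monotone_onI)
    ultimately show ?thesis
      using y_lim nonosc by simp
  qed
qed

end

subsection \<open>Oscillatory solutions\<close>

text \<open>Machin's formula gives pi / 4 = 4 arctan (1/5) - arctan (1/239) < 4/5.\<close>

lemma pi_less_16_5: "pi < 16 / 5"
proof -
  have "0 < arctan (1 / 239 :: real)"
    by (simp add: zero_less_arctan_iff)
  moreover have "arctan (1 / 5 :: real) \<le> 1 / 5"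
    by (rule arctan_le_self) simp
  ultimately show ?thesis
    using machin by linarith
qed

lemma max_abs_imp_deriv_zero:
  fixes x :: "real \<Rightarrow> real"
  assumes der: "(x has_real_derivative D) (at c)" and c: "a < c" "c < b"
    and max: "\<And>t. \<lbrakk>a \<le> t; t \<le> b\<rbrakk> \<Longrightarrow> \<bar>x t\<bar> \<le> \<bar>x c\<bar>"
  shows "D = 0"
proof (cases "0 \<le> x c")
  case True
  show ?thesis
  proof (rule DERIV_local_max[OF der])
    show "\<forall>y. \<bar>c - y\<bar> < min (c - a) (b - c) \<longrightarrow> x y \<le> x c"
      using True max by (auto simp: abs_le_iff)
  qed (use c in auto)
next
  case False
  show ?thesis
  proof (rule DERIV_local_min[OF der])
    show "\<forall>y. \<bar>c - y\<bar> < min (c - a) (b - c) \<longrightarrow> x c \<le> x y"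
    proof (intro allI impI)
      fix y assume "\<bar>c - y\<bar> < min (c - a) (b - c)"
      then have "\<bar>x y\<bar> \<le> \<bar>x c\<bar>" by (intro max) auto
      then show "x c \<le> x y" using False by linarith
    qed
  qed (use c in auto)
qed

section \<open>Bounds on the slope increments in terms of a bound on the solution\<close>

context delay_equation
begin

lemma AE_delayed_bound:
  assumes "s \<le> a" and bd: "\<And>t. \<lbrakk>a - h \<le> t; t \<le> b\<rbrakk> \<Longrightarrow> \<bar>x t\<bar> \<le> M"
  shows "AE t in lebesgue. t \<in> {a..b} \<longrightarrow> - (P * M) \<le> q t * x (t - \<tau> t) \<and> q t * x (t - \<tau> t) \<le> P * M"
  using tau_le q_le
proof eventually_elim
  case (elim t)
  show ?case
  proof
    assume t: "t \<in> {a..b}"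
    then have "\<bar>x (t - \<tau> t)\<bar> \<le> M"
      using elim \<open>s \<le> a\<close> tau_nonneg[of t] by (intro bd) auto
    then have "\<bar>q t * x (t - \<tau> t)\<bar> \<le> P * M"
      using elim q_nonneg[of t] P_pos unfolding abs_mult by (intro mult_mono) auto
    then show "- (P * M) \<le> q t * x (t - \<tau> t) \<and> q t * x (t - \<tau> t) \<le> P * M"
      by (simp add: abs_le_iff)
  qed
qed

lemma solves_deriv_lipschitz:
  assumes sol: "solves x y" and "s \<le> a" "a \<le> b" and bd: "\<And>t. \<lbrakk>a - h \<le> t; t \<le> b\<rbrakk> \<Longrightarrow> \<bar>x t\<bar> \<le> M"
  shows "\<bar>y b - y a\<bar> \<le> P * M * (b - a)"
proof -
  have lower: "- (P * M * (b - a)) \<le> v b - v a"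
    if "solves u v" "\<And>t. \<lbrakk>a - h \<le> t; t \<le> b\<rbrakk> \<Longrightarrow> \<bar>u t\<bar> \<le> M" for u v
  proof (rule solves_ge_integral[OF that(1) assms(2,3)])
    show "((\<lambda>_. - (P * M)) has_integral - (P * M * (b - a))) {a..b}"
      using has_integral_const_real[of "- (P * M)" a b] \<open>a \<le> b\<close> by (simp add: mult.commute)
    show "AE t in lebesgue. t \<in> {a..b} \<longrightarrow> - (P * M) \<le> q t * u (t - \<tau> t)"
      using AE_delayed_bound[OF \<open>s \<le> a\<close>, of b u M] that(2) by (auto elim: eventually_mono)
  qed
  show ?thesis
    using lower[OF sol bd] lower[OF solves_uminus[OF sol]] bd by (auto simp: abs_le_iff)
qed

end

text \<open>In a semicycle with extremum at \<open>c\<close>, let \<open>a\<close> be the last zero before \<open>c\<close>. With time unit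
  \<open>l = 1 / sqrt P\<close> and \<open>h \<le> 8 l / 5\<close>, only the previous values \<open>x u\<close>, \<open>u \<le> a\<close>, bend the graph
  down on \<open>[a, c]\<close>, and those are at least \<open>- M\<close> and at least \<open>- (2 M / l) (a - u)\<close>.\<close>

locale short_delay = delay_equation +
  assumes short: "h * sqrt P < 8 / 5"
begin

definition l :: real where "l = 1 / sqrt P"

lemma l_pos: "0 < l"
  using P_pos by (simp add: l_def)

lemma h_less: "h < 8 / 5 * l"
  using short P_pos by (simp add: l_def field_simps)

lemma P_l_sq: "P * l\<^sup>2 = 1"
  using P_pos by (simp add: l_def power_divide)

text \<open>Landau's inequality on a half-line: \<open>\<bar>x\<bar> \<le> M\<close> and
  \<open>\<bar>x''\<bar> \<le> P * M\<close> give a slope of at most \<open>2 * M * sqrt P\<close>.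
  A larger slope at \<open>u\<close> would persist long enough to the left to make \<open>x\<close>
  vary by more than \<open>2 * M\<close>.\<close>

lemma deriv_le_of_bound:
  assumes sol: "solves x y" and u: "s + 18 / 5 * l \<le> u"
    and bd: "\<And>t. \<lbrakk>u - 18 / 5 * l \<le> t; t \<le> u\<rbrakk> \<Longrightarrow> \<bar>x t\<bar> \<le> M"
  shows "y u \<le> 2 * M / l"
proof -
  \<comment> \<open>The length \<open>2 * l\<close> minimises
    \<open>2 * M / L + P * M * L / 2\<close> over \<open>L\<close>. Adding the delay, shorter than
    \<open>8 / 5 * l\<close>, gives the \<open>18 / 5 * l\<close> of the hypotheses.\<close>
  define a where "a = u - 2 * l"
  have a: "s \<le> a" "a \<le> u" "u - 18 / 5 * l \<le> a - h" "u - 18 / 5 * l \<le> a" "s - h \<le> a"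
    using u l_pos h_less h_nonneg by (auto simp: a_def)
  have y_ge: "y u - P * M * (u - r) \<le> y r" if r: "r \<in> {a..u}" for r
    using solves_deriv_lipschitz[OF sol, of r u M] bd a r by (auto simp: abs_le_iff)
  have "((\<lambda>r. y u - P * M * (u - r)) has_integral
      (y u * u + P * M * (u - u)\<^sup>2 / 2) - (y u * a + P * M * (u - a)\<^sup>2 / 2)) {a..u}"
    by (rule has_integral_real_derivative[OF a(2)]) (auto intro!: derivative_eq_intros simp: field_simps)
  from solves_fst_ge_integral[OF sol a(5,2) this y_ge]
  have "y u * (2 * l) - 2 * M * (P * l\<^sup>2) \<le> x u - x a"
    by (simp add: a_def power2_eq_square algebra_simps)
  moreover have "\<bar>x u\<bar> \<le> M" "\<bar>x a\<bar> \<le> M"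
    using bd a h_nonneg l_pos by auto
  ultimately have "y u * (2 * l) \<le> 4 * M"
    unfolding P_l_sq by linarith
  then show ?thesis
    using l_pos by (simp add: field_simps)
qed

text \<open>The history \<open>7 * l\<close> covers 8/5 back to \<open>a\<close>, 8/5 for the
  delayed arguments before \<open>a\<close>, and 18/5 for the slope bound there: 34/5 in all. The
  factor comes from 22/25 + 1/24 = 553/600.\<close>

lemma positive_maximum_contracts:
  assumes sol: "solves x y" and osc: "oscillatory x" and c: "s + 7 * l \<le> c" and "y c = 0" and "0 < x c"
    and bd: "\<And>t. \<lbrakk>c - 7 * l \<le> t; t \<le> c\<rbrakk> \<Longrightarrow> \<bar>x t\<bar> \<le> M"
  shows "x c \<le> 93 / 100 * M"
proof -
  have "0 \<le> M"
    using bd[of c] l_pos by (auto intro: order_trans[OF abs_ge_zero])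
  have sc: "s \<le> c" using c l_pos by linarith
  have "\<exists>u. c - h \<le> u \<and> u \<le> c \<and> x u \<le> 0"
  proof (rule ccontr)
    assume "\<nexists>u. c - h \<le> u \<and> u \<le> c \<and> x u \<le> 0"
    then have pos: "0 < x t" if "c - h \<le> t" "t \<le> c" for t
      using that by (meson not_le)
    have "0 < x t" if "c \<le> t" for t
      by (rule solves_stays_positive[OF sol sc pos _ that]) (use \<open>y c = 0\<close> in auto)
    then show False
      using osc unfolding oscillatory_def by (metis less_irrefl)
  qed
  then obtain u where u: "c - h \<le> u" "u \<le> c" "x u \<le> 0" by blast
  have cont: "continuous_on {u..c} x"
    using u c l_pos h_less h_nonneg by (intro solves_continuous[OF sol]) linarith
  obtain a where a: "u \<le> a" "a < c" "x a = 0" "\<And>t. \<lbrakk>a < t; t \<le> c\<rbrakk> \<Longrightarrow> 0 < x t"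
    using last_zero_before[OF cont u(2) \<open>0 < x c\<close> u(3)] by blast
  have ca: "c - a \<le> h" "c - a < 8 / 5 * l" "s \<le> a" "s - h \<le> a" "c - 8 / 5 * l \<le> a"
    using u a c h_less l_pos h_nonneg by linarith+
  define A where "A = P * M"
  have A: "0 \<le> A" "A * l\<^sup>2 = M" "A * (l * l) = M"
    using \<open>0 \<le> M\<close> P_pos P_l_sq by (auto simp: A_def mult.assoc mult.commute[of M] power2_eq_square simp flip: mult.assoc)
  \<comment> \<open>\<open>d t\<close> bounds the distance \<open>a - (t - \<tau> t)\<close> by
    which a delayed argument can precede \<open>a\<close>.\<close>
  define d where "d = (\<lambda>t. 8 / 5 * l - (t - a))"
  have d_deriv: "(d has_real_derivative - 1) (at t within S)" for t S
    unfolding d_def by (auto intro!: derivative_eq_intros)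
  have d_nonneg: "0 \<le> d t" if "t \<le> c" for t
    using that ca by (simp add: d_def)
  have x_ge: "- (2 * M / l) * (a - r) \<le> x r" if r: "a - 8 / 5 * l \<le> r" "r \<le> a" for r
  proof -
    have "y v \<le> 2 * M / l" if "v \<in> {r..a}" for v
      using that r ca c a(2) l_pos by (intro deriv_le_of_bound[OF sol] bd) auto
    moreover have "((\<lambda>_. 2 * M / l) has_integral (2 * M / l) * (a - r)) {r..a}"
      using has_integral_const_real[of "2 * M / l" r a] r by (simp add: mult.commute)
    moreover have "s - h \<le> r" using r ca c l_pos h_nonneg by linarith
    ultimately show ?thesis
      using solves_fst_le_integral[OF sol _ r(2)] a(3) by fastforce
  qed
  have x''_ge: "AE t in lebesgue. t \<in> {a..c} \<longrightarrow> - (2 * A / l) * d t \<le> q t * x (t - \<tau> t)"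
    using tau_le q_le
  proof eventually_elim
    case (elim t)
    show ?case
    proof
      assume t: "t \<in> {a..c}"
      then have \<tau>: "\<tau> t \<le> 8 / 5 * l" "0 \<le> \<tau> t" "q t \<le> P"
        using elim ca h_less tau_nonneg[of t] by auto
      show "- (2 * A / l) * d t \<le> q t * x (t - \<tau> t)"
      proof (cases "t - \<tau> t > a")
        case True
        have "- (2 * A / l) * d t \<le> 0"
          using A l_pos d_nonneg[of t] t by simp
        also have "0 \<le> q t * x (t - \<tau> t)"
          using a(4)[OF True] \<tau> t q_nonneg[of t] by simp
        finally show ?thesis .
      next
        case False
        have "- (2 * A / l) * d t \<le> - (2 * A / l) * (a - (t - \<tau> t))"
          using A l_pos t \<tau> by (intro mult_left_mono_neg) (auto simp: d_def)
        also have "\<dots> = - (P * ((2 * M / l) * (a - (t - \<tau> t))))"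
          by (simp add: A_def)
        also have "\<dots> \<le> - (q t * ((2 * M / l) * (a - (t - \<tau> t))))"
          using \<tau> False \<open>0 \<le> M\<close> l_pos by (intro le_imp_neg_le mult_right_mono) auto
        also have "\<dots> = q t * (- (2 * M / l) * (a - (t - \<tau> t)))"
          by simp
        also have "\<dots> \<le> q t * x (t - \<tau> t)"
          using False t \<tau> by (intro mult_left_mono x_ge q_nonneg) auto
        finally show ?thesis .
      qed
    qed
  qed
  \<comment> \<open>Integrate \<open>x''_ge\<close> back from the critical point \<open>c\<close>,
    where \<open>y\<close> vanishes.\<close>
  have y_le_sq: "y r \<le> A / l * (d r)\<^sup>2" if r: "a \<le> r" "r \<le> c" for r
  proof -
    have "((\<lambda>t. - (2 * A / l) * d t) has_integral A / l * (d c)\<^sup>2 - A / l * (d r)\<^sup>2) {r..c}"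
      by (rule has_integral_real_derivative[OF r(2)])
         (use l_pos in \<open>auto intro!: derivative_eq_intros d_deriv\<close>)
    moreover have "s \<le> r" using ca r by linarith
    moreover have "AE t in lebesgue. t \<in> {r..c} \<longrightarrow> - (2 * A / l) * d t \<le> q t * x (t - \<tau> t)"
      using x''_ge by eventually_elim (use r in auto)
    ultimately have "A / l * (d c)\<^sup>2 - A / l * (d r)\<^sup>2 \<le> y c - y r"
      using solves_ge_integral[OF sol _ r(2)] by blast
    moreover have "0 \<le> A / l * (d c)\<^sup>2" using A l_pos by simp
    ultimately show ?thesis using \<open>y c = 0\<close> by linarith
  qed
  have y_lip: "y r \<le> y v + A * (v - r)" if "a \<le> r" "r \<le> v" "v \<le> c" for r v
  proof -
    have "\<bar>y v - y r\<bar> \<le> P * M * (v - r)"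
      using that ca c h_less l_pos by (intro solves_deriv_lipschitz[OF sol] bd) auto
    then show ?thesis by (simp add: A_def abs_le_iff)
  qed
  \<comment> \<open>At \<open>r1\<close> the two bounds on \<open>x''\<close> agree:
    \<open>d r1 = l / 2\<close>, so \<open>(2 * A / l) * d r1 = A\<close>. To the left of it the
    constant bound \<open>- A\<close> is the better one.\<close>
  define r1 where "r1 = a + 11 / 10 * l"
  define c1 where "c1 = min c r1"
  have c1: "a \<le> c1" "c1 \<le> c" "c1 - a \<le> 11 / 10 * l"
    using a(2) l_pos unfolding c1_def r1_def by linarith+
  \<comment> \<open>27/20 = 11/10 + 1/4, where \<open>A * l / 4\<close> is the value at
    \<open>r1\<close> of the quadratic bound \<open>y_le_sq\<close>.\<close>
  have "y c1 \<le> A * (27 / 20 * l - (c1 - a))"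
  proof (cases "c \<le> r1")
    case True
    then show ?thesis
      using \<open>y c = 0\<close> A c1 l_pos by (simp add: c1_def)
  next
    case False
    then have *: "d c1 = l / 2" "c1 - a = 11 / 10 * l"
      by (auto simp: c1_def d_def r1_def)
    have **: "A / l * (l / 2)\<^sup>2 = A * (27 / 20 * l - 11 / 10 * l)"
      using l_pos by (simp add: power2_eq_square field_simps)
    show ?thesis
      using y_le_sq[OF c1(1,2)] unfolding * ** .
  qed
  then have y_le_lin: "y r \<le> A * (27 / 20 * l - (r - a))" if "r \<in> {a..c1}" for r
    using y_lip[of r c1] that c1 by (simp add: algebra_simps)
  have "((\<lambda>r. A * (27 / 20 * l - (r - a))) has_integral
      A * (27 / 20 * l * (c1 - a) - (c1 - a)\<^sup>2 / 2) - A * (27 / 20 * l * (a - a) - (a - a)\<^sup>2 / 2)) {a..c1}"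
    by (rule has_integral_real_derivative[OF c1(1)])
       (auto intro!: derivative_eq_intros arg_cong[of _ _ "(*) A"] simp: field_simps)
  from solves_fst_le_integral[OF sol ca(4) c1(1) this y_le_lin]
  have "x c1 \<le> A * (27 / 20 * l * (c1 - a) - (c1 - a)\<^sup>2 / 2)"
    using a(3) by simp
  also have "\<dots> \<le> A * (22 / 25 * l\<^sup>2)"
  proof (rule mult_left_mono[OF _ A(1)])
    \<comment> \<open>The quadratic bound takes the value 22/25 at
      \<open>c1 - a = 11 / 10 * l\<close>; the difference to it has this factorisation.\<close>
    have "0 \<le> (11 / 10 * l - (c1 - a)) * (4 / 5 * l - (c1 - a) / 2)"
      using c1 l_pos by (intro mult_nonneg_nonneg) auto
    moreover have "(11 / 10 * l - L) * (4 / 5 * l - L / 2) = 22 / 25 * l\<^sup>2 - (27 / 20 * l * L - L\<^sup>2 / 2)" for L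
      by (simp add: power2_eq_square field_simps)
    ultimately show "27 / 20 * l * (c1 - a) - (c1 - a)\<^sup>2 / 2 \<le> 22 / 25 * l\<^sup>2"
      by simp
  qed
  finally have x_c1: "x c1 \<le> 22 / 25 * M"
    using A by simp
  \<comment> \<open>Beyond \<open>r1\<close> the quadratic slope bound integrates to at most
    \<open>(A / l) * (l / 2) ^ 3 / 3\<close>.\<close>
  have "x c - x c1 \<le> 1 / 24 * M"
  proof (cases "c \<le> r1")
    case True
    then show ?thesis using \<open>0 \<le> M\<close> by (simp add: c1_def)
  next
    case False
    then have d_c1: "d c1 = l / 2"
      by (auto simp: c1_def d_def r1_def)
    have "((\<lambda>r. A / l * (d r)\<^sup>2) has_integral - (A / l * (d c) ^ 3 / 3) - - (A / l * (d c1) ^ 3 / 3)) {c1..c}"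
      by (rule has_integral_real_derivative[OF c1(2)])
         (use l_pos in \<open>auto intro!: derivative_eq_intros d_deriv\<close>)
    from solves_fst_le_integral[OF sol _ c1(2) this] y_le_sq c1 ca
    have "x c - x c1 \<le> - (A / l * (d c) ^ 3 / 3) - - (A / l * (d c1) ^ 3 / 3)"
      by auto
    also have "\<dots> \<le> A / l * (l / 2) ^ 3 / 3"
      using A l_pos d_nonneg[of c] by (simp add: d_c1)
    also have "\<dots> = 1 / 24 * (A * l\<^sup>2)"
      using l_pos by (simp add: field_simps power2_eq_square power3_eq_cube)
    finally show ?thesis using A by simp
  qed
  with x_c1 \<open>0 \<le> M\<close> show ?thesis by linarith
qed

lemma oscillatory_uminus: "oscillatory x \<Longrightarrow> oscillatory (\<lambda>t. - x t)"
  by (simp add: oscillatory_def)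

lemma extremum_contracts:
  assumes sol: "solves x y" and osc: "oscillatory x" and "s + 7 * l \<le> c" and "y c = 0"
    and bd: "\<And>t. \<lbrakk>c - 7 * l \<le> t; t \<le> c\<rbrakk> \<Longrightarrow> \<bar>x t\<bar> \<le> M"
  shows "\<bar>x c\<bar> \<le> 93 / 100 * M"
proof -
  have "0 \<le> M"
    using bd[of c] l_pos by (auto intro: order_trans[OF abs_ge_zero])
  consider "0 < x c" | "x c = 0" | "x c < 0" by linarith
  then show ?thesis
  proof cases
    case 1
    then show ?thesis
      using positive_maximum_contracts[OF sol osc assms(3,4) 1 bd] by simp
  next
    case 3
    then show ?thesis
      using positive_maximum_contracts[OF solves_uminus[OF sol] oscillatory_uminus[OF osc] assms(3), of M] assms(4) bd
      by simp
  qed (use \<open>0 \<le> M\<close> in simp)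
qed

text \<open>The zero at \<open>b\<close> keeps the maximum of \<open>\<bar>x\<bar>\<close> off the
  right end, so it is a critical point unless it sits at \<open>a\<close>. Oscillation supplies such
  a \<open>b\<close> beyond any \<open>t\<close>.\<close>

lemma interior_max_abs:
  assumes sol: "solves x y" and "s \<le> a" "a \<le> t" "t \<le> b" "x b = 0" "x t \<noteq> 0"
  obtains c where "a \<le> c" "c < b" "\<And>r. \<lbrakk>a \<le> r; r \<le> b\<rbrakk> \<Longrightarrow> \<bar>x r\<bar> \<le> \<bar>x c\<bar>" "a < c \<Longrightarrow> y c = 0"
proof -
  have "continuous_on {a..b} (\<lambda>t. \<bar>x t\<bar>)"
    using assms(2) h_nonneg by (intro continuous_on_rabs solves_continuous[OF sol]) linarith
  then obtain c where c: "c \<in> {a..b}" "\<And>r. r \<in> {a..b} \<Longrightarrow> \<bar>x r\<bar> \<le> \<bar>x c\<bar>"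
    using continuous_attains_sup[of "{a..b}" "\<lambda>t. \<bar>x t\<bar>"] assms by fastforce
  have "\<bar>x c\<bar> > 0"
    using c(2)[of t] assms by auto
  then have "c < b"
    using c(1) assms by (cases "c = b") auto
  have "y c = 0" if "a < c"
    using max_abs_imp_deriv_zero[OF solves_has_derivative[OF sol] that \<open>c < b\<close>] c that assms(2) h_nonneg by auto
  with c \<open>c < b\<close> show thesis by (intro that) auto
qed

theorem oscillatory_solution_tendsto_zero:
  assumes sol: "solves x y" and osc: "oscillatory x"
  shows "(x \<longlongrightarrow> 0) at_top"
proof -
  define T0 where "T0 = s + 7 * l"
  have "continuous_on {s..T0} x"
    using h_nonneg by (intro solves_continuous[OF sol]) linarith
  from compact_imp_bounded[OF compact_continuous_image[OF this compact_Icc]]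
  obtain M where M: "\<And>t. t \<in> {s..T0} \<Longrightarrow> \<bar>x t\<bar> \<le> M"
    unfolding bounded_iff by (metis image_eqI real_norm_def)
  have bounded: "\<bar>x t\<bar> \<le> M" if t: "s \<le> t" for t
  proof (rule ccontr)
    assume gt: "\<not> \<bar>x t\<bar> \<le> M"
    have "0 \<le> M" using M[of s] l_pos by (auto simp: T0_def intro: order_trans[OF abs_ge_zero])
    obtain b where b: "t \<le> b" "x b = 0"
      using osc unfolding oscillatory_def by blast
    have "x t \<noteq> 0" using gt \<open>0 \<le> M\<close> by auto
    then obtain c where c: "s \<le> c" "c < b" "\<And>r. \<lbrakk>s \<le> r; r \<le> b\<rbrakk> \<Longrightarrow> \<bar>x r\<bar> \<le> \<bar>x c\<bar>" "s < c \<Longrightarrow> y c = 0"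
      using interior_max_abs[OF sol order_refl t b] by blast
    have "\<bar>x t\<bar> \<le> \<bar>x c\<bar>"
      using c(3) t b by blast
    then have "T0 < c"
      using M[of c] c(1) gt by (cases "c \<le> T0") auto
    \<comment> \<open>The extremum itself bounds all earlier values from \<open>s\<close> on, so the
      contraction is applied with \<open>M = \<bar>x c\<bar>\<close>.\<close>
    then have "\<bar>x c\<bar> \<le> 93 / 100 * \<bar>x c\<bar>"
      using c l_pos by (intro extremum_contracts[OF sol osc]) (auto simp: T0_def)
    then have "x c = 0" by simp
    then show False using c(3)[of t] t b gt \<open>0 \<le> M\<close> by simp
  qed
  \<comment> \<open>Past a zero \<open>z \<ge> T + 7 * l\<close>, every nonzero value is dominated
    by a critical value whose whole relevant history lies beyond \<open>T\<close>.\<close>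
  have step: "\<exists>T'. \<forall>t\<ge>T'. \<bar>x t\<bar> \<le> 93 / 100 * M'"
    if T: "s \<le> T" and M': "\<And>t. T \<le> t \<Longrightarrow> \<bar>x t\<bar> \<le> M'" for T M'
  proof -
    have "0 \<le> M'" using M'[of T] by (auto intro: order_trans[OF abs_ge_zero])
    obtain z where z: "T + 7 * l \<le> z" "x z = 0"
      using osc unfolding oscillatory_def by blast
    have "\<bar>x t\<bar> \<le> 93 / 100 * M'" if t: "z \<le> t" for t
    proof (cases "x t = 0")
      case False
      obtain b where b: "t \<le> b" "x b = 0"
        using osc unfolding oscillatory_def by blast
      have "s \<le> z" using T z l_pos by linarith
      obtain c where c: "z \<le> c" "c < b" "\<And>r. \<lbrakk>z \<le> r; r \<le> b\<rbrakk> \<Longrightarrow> \<bar>x r\<bar> \<le> \<bar>x c\<bar>" "z < c \<Longrightarrow> y c = 0"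
        using interior_max_abs[OF sol \<open>s \<le> z\<close> t b False] by blast
      have "z \<noteq> c"
        using c(3)[of t] t b False z by auto
      then have "\<bar>x c\<bar> \<le> 93 / 100 * M'"
        using c z T by (intro extremum_contracts[OF sol osc] M') auto
      then show ?thesis
        using c(3)[of t] t b by simp
    qed (use \<open>0 \<le> M'\<close> in simp)
    then show ?thesis by blast
  qed
  have iter: "\<exists>T\<ge>s. \<forall>t\<ge>T. \<bar>x t\<bar> \<le> (93 / 100) ^ n * M" for n
  proof (induction n)
    case 0
    then show ?case using bounded by auto
  next
    case (Suc n)
    then obtain T where "s \<le> T" "\<And>t. T \<le> t \<Longrightarrow> \<bar>x t\<bar> \<le> (93 / 100) ^ n * M" by blast
    from step[OF this] obtain T' where "\<And>t. T' \<le> t \<Longrightarrow> \<bar>x t\<bar> \<le> 93 / 100 * ((93 / 100) ^ n * M)" by blast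
    then show ?case
      by (intro exI[of _ "max s T'"]) (simp add: mult.assoc)
  qed
  show ?thesis
    unfolding tendsto_iff
  proof (intro allI impI)
    fix e :: real assume "e > 0"
    have "(\<lambda>n. (93 / 100) ^ n * M) \<longlonglongrightarrow> 0 * M"
      by (intro tendsto_mult tendsto_const LIMSEQ_realpow_zero) auto
    then have "\<forall>\<^sub>F n in sequentially. (93 / 100) ^ n * M < e"
      using \<open>e > 0\<close> by (intro order_tendstoD(2)) auto
    then obtain n where "(93 / 100) ^ n * M < e"
      using eventually_happens'[OF sequentially_bot] by blast
    with iter[of n] obtain T where "\<And>t. T \<le> t \<Longrightarrow> \<bar>x t\<bar> < e"
      by (meson le_less_trans)
    then show "\<forall>\<^sub>F t in at_top. dist (x t) 0 < e"
      by (intro eventually_at_top_linorderI[of T]) (simp add: dist_real_def)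
  qed
qed

end

subsection \<open>The initial value problem\<close>

lemma integral_left_zero:
  fixes H :: "real \<Rightarrow> real"
  assumes "b \<le> s" "\<And>r. r \<le> s \<Longrightarrow> H r = 0"
  shows "integral {a..b} H = 0"
proof -
  have "integral {a..b} H = integral {a..b} (\<lambda>_. 0)"
    using assms by (intro integral_cong) auto
  then show ?thesis by simp
qed

text \<open>For \<open>v < s\<close> the interval \<open>{s..v}\<close> is empty and its integral 0,
  which agrees with an integrand vanishing left of \<open>s\<close>. So additivity holds wherever
  \<open>s\<close> lies, and the indefinite integral is well behaved across
  \<open>s\<close>.\<close>

lemma integral_combine_left_zero:
  fixes H :: "real \<Rightarrow> real"
  assumes int: "\<And>a b. H integrable_on {a..b}" and zero: "\<And>r. r \<le> s \<Longrightarrow> H r = 0" and "u \<le> v"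
  shows "integral {s..v} H = integral {s..u} H + integral {u..v} H"
proof -
  have left: "integral {a..b} H = 0" if "b \<le> s" for a b
    using integral_left_zero[OF that zero] .
  have empty: "integral {s..b} H = 0" if "b \<le> s" for b
    using that by (rule left)
  show ?thesis
  proof (cases "s \<le> u")
    case True
    then show ?thesis
      using Henstock_Kurzweil_Integration.integral_combine[OF True \<open>u \<le> v\<close> int] by simp
  next
    case False
    show ?thesis
    proof (cases "s \<le> v")
      case True
      then show ?thesis
        using Henstock_Kurzweil_Integration.integral_combine[of u s v, OF _ True int] False left[of s u] empty[of u] by simp
    qed (use left False in simp)
  qed
qed

lemma continuous_on_integral_left_zero:
  fixes H :: "real \<Rightarrow> real"
  assumes int: "\<And>a b. H integrable_on {a..b}" and zero: "\<And>r. r \<le> s \<Longrightarrow> H r = 0"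
  shows "continuous_on UNIV (\<lambda>v. integral {s..v} H)"
proof (intro continuous_at_imp_continuous_on ballI)
  fix t
  have "continuous_on {t - 1..t + 1} (\<lambda>v. integral {s..t - 1} H + integral {t - 1..v} H)"
    by (intro continuous_intros indefinite_integral_continuous_1 int)
  then have "continuous_on {t - 1..t + 1} (\<lambda>v. integral {s..v} H)"
    by (rule continuous_on_eq) (rule integral_combine_left_zero[of H s, OF int zero, symmetric], auto)
  then show "isCont (\<lambda>v. integral {s..v} H) t"
    by (rule continuous_on_interior) simp
qed

lemma has_real_derivative_integral_left_zero:
  fixes H :: "real \<Rightarrow> real"
  assumes cont: "continuous_on UNIV H" and zero: "\<And>r. r \<le> s \<Longrightarrow> H r = 0"
  shows "((\<lambda>v. integral {s..v} H) has_real_derivative H t) (at t)"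
proof -
  have int: "H integrable_on {a..b}" for a b
    by (intro integrable_continuous_interval continuous_on_subset[OF cont]) simp
  have "((\<lambda>v. integral {t - 1..v} H) has_real_derivative H t) (at t within {t - 1..t + 1})"
    by (intro integral_has_real_derivative continuous_on_subset[OF cont]) auto
  moreover have "at t within {t - 1..t + 1} = at t"
    by (rule at_within_interior) simp
  ultimately have D: "((\<lambda>v. integral {s..t - 1} H + integral {t - 1..v} H) has_real_derivative H t) (at t)"
    using DERIV_add[OF DERIV_const] by fastforce
  show ?thesis
  proof (rule has_field_derivative_transform_within_open[OF D, of "{t - 1<..<t + 1}"])
    show "integral {s..t - 1} H + integral {t - 1..v} H = integral {s..v} H" if "v \<in> {t - 1<..<t + 1}" for v
      using integral_combine_left_zero[of H s, OF int zero, of "t - 1" v] that by simp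
  qed auto
qed

text \<open>Each integration of an exponential bound gains a factor \<open>1 / \<mu>\<close>; two
  integrations give the \<open>1 / \<mu>\<^sup>2\<close> of the contraction.\<close>

lemma abs_integral_le_exp:
  fixes H :: "real \<Rightarrow> real"
  assumes H: "H \<in> borel_measurable lebesgue" and "0 < \<mu>" "0 \<le> C"
    and le: "AE r in lebesgue. s \<le> r \<longrightarrow> \<bar>H r\<bar> \<le> C * exp (\<mu> * (r - s))"
  shows "\<bar>integral {s..v} H\<bar> \<le> C / \<mu> * exp (\<mu> * (v - s))"
proof (cases "s \<le> v")
  case True
  have G: "((\<lambda>r. C * exp (\<mu> * (r - s))) has_integral C / \<mu> * exp (\<mu> * (v - s)) - C / \<mu> * exp (\<mu> * (s - s))) {s..v}"
    by (rule has_integral_real_derivative[OF True]) (use \<open>0 < \<mu>\<close> in \<open>auto intro!: derivative_eq_intros\<close>)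
  have "\<bar>integral {s..v} H\<bar> \<le> integral {s..v} (\<lambda>r. C * exp (\<mu> * (r - s)))"
    using le by (intro integrable_on_if_AE_le(2)[OF H has_integral_integrable[OF G]]) (auto elim: eventually_mono)
  also have "\<dots> \<le> C / \<mu> * exp (\<mu> * (v - s))"
    using integral_unique[OF G] \<open>0 < \<mu>\<close> \<open>0 \<le> C\<close> by simp
  finally show ?thesis .
qed (use assms in simp)

context delay_equation
begin

text \<open>Writing \<open>x t = \<alpha> + \<beta> (t - s) + w t\<close>, the function \<open>z t = exp (- \<mu> max (t - s) 0) w t\<close> is the
  fixed point of an operator on bounded continuous functions, contracting because
  \<open>P / \<mu>\<^sup>2 = 1 / 4\<close>.\<close>

theorem initial_value_problem_solvable:
  "\<exists>x y. solves x y \<and> (\<forall>t\<le>s. x t = \<alpha> + \<beta> * (t - s) \<and> y t = \<beta>)"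
proof -
  define \<mu> where "\<mu> = 2 * sqrt P"
  have \<mu>: "0 < \<mu>" "P / \<mu> / \<mu> = 1 / 4"
    using P_pos by (auto simp: \<mu>_def)
  define \<phi> where "\<phi> = (\<lambda>t. \<alpha> + \<beta> * (t - s))"
  \<comment> \<open>The weight is constant left of \<open>s\<close> and nondecreasing, so a delayed
    argument never has a larger weight.\<close>
  define W where "W = (\<lambda>t. exp (\<mu> * max (t - s) 0))"
  have W_pos: "0 < W t" for t by (simp add: W_def)
  have W_cont: "continuous_on S W" for S
    unfolding W_def by (intro continuous_intros)
  have W_mono: "W t \<le> W r" if "t \<le> r" for t r
    using that \<mu> by (auto simp: W_def)
  \<comment> \<open>\<open>F z\<close> is the second derivative that the equation prescribes for
    \<open>w = W * z\<close>. Its value 0 up to \<open>s\<close> leaves the initial function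
    \<open>\<phi>\<close> unperturbed; \<open>I1\<close> and \<open>I2\<close> are its successive
    integrals.\<close>
  define F where "F = (\<lambda>(z :: real \<Rightarrow>\<^sub>C real) r. if r \<le> s then 0 else q r * (\<phi> (r - \<tau> r) + W (r - \<tau> r) * z (r - \<tau> r)))"
  define I1 where "I1 = (\<lambda>z v. integral {s..v} (F z))"
  define I2 where "I2 = (\<lambda>z t. integral {s..t} (I1 z))"
  \<comment> \<open>\<open>K * exp (\<mu> * (r - s))\<close> dominates the affine
    \<open>\<phi>\<close> at delayed arguments: \<open>h\<close> accounts for the delay, and
    \<open>1 / \<mu>\<close> comes from
    \<open>\<mu> * (r - s) \<le> exp (\<mu> * (r - s))\<close>.\<close>
  define K where "K = \<bar>\<alpha>\<bar> + \<bar>\<beta>\<bar> * (h + 1 / \<mu>)"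
  have K: "0 \<le> K" using h_nonneg \<mu> by (simp add: K_def)
  have F_meas: "F z \<in> borel_measurable lebesgue" for z
  proof -
    have [measurable]: "q \<in> borel_measurable lebesgue" "\<tau> \<in> borel_measurable lebesgue"
      by (fact q_measurable tau_measurable)+
    have [measurable]: "(\<lambda>r. r - \<tau> r) \<in> borel_measurable lebesgue"
      by (intro borel_measurable_diff) (auto intro: measurable_completion)
    have [measurable]: "(\<lambda>r. \<phi> (r - \<tau> r) + W (r - \<tau> r) * z (r - \<tau> r)) \<in> borel_measurable lebesgue"
      by (rule borel_measurable_continuous_on[of "\<lambda>u. \<phi> u + W u * z u"])
         (auto simp: \<phi>_def intro!: continuous_intros W_cont)
    have "{r. r \<le> s} \<in> sets lebesgue" by simp
    then show ?thesis
      unfolding F_def by (intro measurable_If) (auto intro: q_measurable)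
  qed
  have W_eq: "W r = exp (\<mu> * (r - s))" if "s \<le> r" for r
    using that by (simp add: W_def max_def)
  have \<phi>_le: "\<bar>\<phi> (r - \<tau> r)\<bar> \<le> K * exp (\<mu> * (r - s))" if "s \<le> r" "\<tau> r \<le> h" for r
  proof -
    have "\<mu> * (r - s) \<le> exp (\<mu> * (r - s))"
      using exp_ge_add_one_self[of "\<mu> * (r - s)"] by linarith
    then have rs: "r - s \<le> 1 / \<mu> * exp (\<mu> * (r - s))"
      using \<mu> by (simp add: field_simps)
    have e: "1 \<le> exp (\<mu> * (r - s))" using \<mu> that by simp
    have "h \<le> h * exp (\<mu> * (r - s))"
      using mult_left_mono[OF e h_nonneg] by simp
    then have "\<bar>r - \<tau> r - s\<bar> \<le> (h + 1 / \<mu>) * exp (\<mu> * (r - s))"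
      using that tau_nonneg[of r] rs unfolding distrib_right by linarith
    then have "\<bar>\<beta>\<bar> * \<bar>r - \<tau> r - s\<bar> \<le> \<bar>\<beta>\<bar> * ((h + 1 / \<mu>) * exp (\<mu> * (r - s)))"
      by (intro mult_left_mono) auto
    moreover have "\<bar>\<alpha>\<bar> \<le> \<bar>\<alpha>\<bar> * exp (\<mu> * (r - s))"
      using mult_left_mono[OF e, of "\<bar>\<alpha>\<bar>"] by simp
    moreover have "\<bar>\<phi> (r - \<tau> r)\<bar> \<le> \<bar>\<alpha>\<bar> + \<bar>\<beta>\<bar> * \<bar>r - \<tau> r - s\<bar>"
      unfolding \<phi>_def abs_mult[symmetric] by (rule abs_triangle_ineq)
    ultimately show ?thesis
      unfolding K_def by (simp add: algebra_simps)
  qed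
  have F_le: "AE r in lebesgue. \<bar>F z r\<bar> \<le> P * (K + B) * exp (\<mu> * (r - s))"
    if B: "\<And>t. \<bar>apply_bcontfun z t\<bar> \<le> B" for z B
    using tau_le q_le
  proof eventually_elim
    case (elim r)
    have "0 \<le> B" using B[of 0] by linarith
    show ?case
    proof (cases "r \<le> s")
      case False
      have "\<bar>W (r - \<tau> r) * z (r - \<tau> r)\<bar> \<le> W r * B"
        unfolding abs_mult using W_mono[of "r - \<tau> r" r] W_pos tau_nonneg[of r] B \<open>0 \<le> B\<close>
        by (intro mult_mono) (auto simp: less_imp_le)
      moreover have "\<bar>\<phi> (r - \<tau> r)\<bar> \<le> K * W r"
        using \<phi>_le[of r] W_eq[of r] False elim by simp
      ultimately have "\<bar>\<phi> (r - \<tau> r) + W (r - \<tau> r) * z (r - \<tau> r)\<bar> \<le> (K + B) * W r"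
        by (simp add: algebra_simps)
      then have "\<bar>F z r\<bar> \<le> P * ((K + B) * W r)"
        using False elim q_nonneg[of r] P_pos unfolding F_def by (simp add: abs_mult mult_mono)
      then show ?thesis
        using False W_eq[of r] by simp
    qed (use P_pos K \<open>0 \<le> B\<close> in \<open>simp add: F_def\<close>)
  qed
  have bdd: "\<exists>B\<ge>0. \<forall>t. \<bar>apply_bcontfun z t\<bar> \<le> B" for z :: "real \<Rightarrow>\<^sub>C real"
    using bounded_apply_bcontfun[of z] unfolding bounded_iff
    by (metis UNIV_I abs_ge_zero image_eqI order_trans real_norm_def)
  have F_int: "F z integrable_on {a..b}" for z a b
  proof -
    obtain B where B: "\<And>t. \<bar>apply_bcontfun z t\<bar> \<le> B" using bdd by blast
    show ?thesis
      using F_le[OF B] by (intro integrable_on_if_AE_le(1)[OF F_meas, of "\<lambda>r. P * (K + B) * exp (\<mu> * (r - s))"] integrable_continuous_interval continuous_intros)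
        (auto elim: eventually_mono)
  qed
  have F_zero: "F z r = 0" if "r \<le> s" for z r using that by (simp add: F_def)
  have I1_cont: "continuous_on S (I1 z)" for S z
    unfolding I1_def by (rule continuous_on_subset[OF continuous_on_integral_left_zero[of "F z" s, OF F_int F_zero]]) auto
  have I1_zero: "I1 z r = 0" if "r \<le> s" for z r
    unfolding I1_def using integral_left_zero[OF that F_zero] .
  have I1_int: "I1 z integrable_on {a..b}" for z a b
    by (intro integrable_continuous_interval I1_cont)
  have I1_meas: "I1 z \<in> borel_measurable lebesgue" for z
    using borel_measurable_continuous_onI[OF I1_cont] by (auto intro: measurable_completion)
  have I2_deriv: "(I2 z has_real_derivative I1 z t) (at t)" for z t
    unfolding I2_def by (rule has_real_derivative_integral_left_zero[of "I1 z" s, OF I1_cont I1_zero])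
  have I2_zero: "I2 z r = 0" if "r \<le> s" for z r
    unfolding I2_def using integral_left_zero[OF that I1_zero] .
  have I2_cont: "continuous_on S (I2 z)" for S z
    by (rule continuous_on_subset[of UNIV]) (auto intro: DERIV_isCont[OF I2_deriv] continuous_at_imp_continuous_on)
  have I2_diff_le: "\<bar>I2 z t - I2 z' t\<bar> \<le> D / 4 * W t"
    if "0 \<le> D" and D: "\<And>t. \<bar>apply_bcontfun z t - apply_bcontfun z' t\<bar> \<le> D" for z z' D t
  proof -
    have 1: "\<bar>I1 z v - I1 z' v\<bar> \<le> P * D / \<mu> * exp (\<mu> * (v - s))" for v
    proof -
      have "AE r in lebesgue. s \<le> r \<longrightarrow> \<bar>F z r - F z' r\<bar> \<le> P * D * exp (\<mu> * (r - s))"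
        using q_le
      proof eventually_elim
        case (elim r)
        show ?case
        proof
          assume "s \<le> r"
          have "\<bar>F z r - F z' r\<bar> \<le> q r * (W (r - \<tau> r) * \<bar>z (r - \<tau> r) - z' (r - \<tau> r)\<bar>)"
            using q_nonneg[of r] W_pos[of "r - \<tau> r"]
            by (auto simp: F_def abs_mult simp flip: right_diff_distrib)
          also have "\<dots> \<le> P * (W r * D)"
            using elim q_nonneg[of r] W_pos[of "r - \<tau> r"] W_pos[of r] W_mono[of "r - \<tau> r" r] tau_nonneg[of r] D P_pos \<open>0 \<le> D\<close>
            by (intro mult_mono mult_nonneg_nonneg) auto
          finally show "\<bar>F z r - F z' r\<bar> \<le> P * D * exp (\<mu> * (r - s))"
            using W_eq[OF \<open>s \<le> r\<close>] by (simp add: mult_ac)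
        qed
      qed
      then have "\<bar>integral {s..v} (\<lambda>r. F z r - F z' r)\<bar> \<le> P * D / \<mu> * exp (\<mu> * (v - s))"
        using \<mu> P_pos \<open>0 \<le> D\<close> by (intro abs_integral_le_exp borel_measurable_diff F_meas) auto
      then show ?thesis
        unfolding I1_def by (simp add: integral_diff F_int)
    qed
    show ?thesis
    proof (cases "s \<le> t")
      case True
      have "\<bar>integral {s..t} (\<lambda>r. I1 z r - I1 z' r)\<bar> \<le> P * D / \<mu> / \<mu> * exp (\<mu> * (t - s))"
        using \<mu> P_pos \<open>0 \<le> D\<close> 1 by (intro abs_integral_le_exp borel_measurable_diff I1_meas) auto
      also have "P * D / \<mu> / \<mu> = D / 4"
        using \<mu>(2) by (metis mult.commute mult.right_neutral times_divide_eq_right)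
      finally show ?thesis
        unfolding I2_def W_eq[OF True] by (simp only: integral_diff[OF I1_int I1_int])
    qed (use I2_zero \<open>0 \<le> D\<close> W_pos[of t] in simp)
  qed
  define T where "T = (\<lambda>z. Bcontfun (\<lambda>t. I2 z t / W t))"
  have T: "apply_bcontfun (T z) = (\<lambda>t. I2 z t / W t)" for z
  proof -
    have cont: "continuous_on UNIV (\<lambda>t. I2 z t / W t)"
      using W_pos by (intro continuous_intros I2_cont W_cont) (metis less_irrefl)
    obtain B where B: "0 \<le> B" "\<And>t. \<bar>apply_bcontfun z t\<bar> \<le> B" using bdd by blast
    have 1: "\<bar>I1 z v\<bar> \<le> P * (K + B) / \<mu> * exp (\<mu> * (v - s))" for v
      unfolding I1_def using F_le[OF B(2)] \<mu> P_pos K B(1)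
      by (intro abs_integral_le_exp[OF F_meas]) (auto elim: eventually_mono)
    have "\<bar>I2 z t / W t\<bar> \<le> P * (K + B) / \<mu> / \<mu>" for t
    proof (cases "s \<le> t")
      case True
      have "\<bar>I2 z t\<bar> \<le> P * (K + B) / \<mu> / \<mu> * exp (\<mu> * (t - s))"
        unfolding I2_def using 1 \<mu> P_pos K B(1) by (intro abs_integral_le_exp[OF I1_meas]) auto
      then show ?thesis
        using W_eq[OF True] W_pos[of t] by (simp add: abs_divide pos_divide_le_eq)
    qed (use I2_zero \<mu> P_pos K B(1) in simp)
    then have "bounded (range (\<lambda>t. I2 z t / W t))"
      unfolding bounded_iff by (intro exI[of _ "P * (K + B) / \<mu> / \<mu>"]) simp
    with cont show ?thesis
      unfolding T_def by (intro Bcontfun_inverse) (simp add: bcontfun_def)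
  qed
  have "dist (T z) (T z') \<le> 1 / 4 * dist z z'" for z z'
  proof (rule dist_bound)
    fix t
    have "\<bar>I2 z t - I2 z' t\<bar> \<le> dist z z' / 4 * W t"
      by (rule I2_diff_le) (auto simp: dist_bounded simp flip: dist_real_def)
    then show "dist (apply_bcontfun (T z) t) (apply_bcontfun (T z') t) \<le> 1 / 4 * dist z z'"
      using W_pos[of t] by (simp add: T dist_real_def abs_divide pos_divide_le_eq flip: diff_divide_distrib)
  qed
  then obtain z where z: "T z = z"
    using banach_fix_type[of "1/4" T] by auto
  have W_z: "W t * z t = I2 z t" for t
    using fun_cong[OF T[of z], of t] W_pos[of t] unfolding z by (simp add: field_simps)
  define x where "x = (\<lambda>t. \<phi> t + I2 z t)"
  define y where "y = (\<lambda>t. \<beta> + I1 z t)"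
  have "(x has_real_derivative y t) (at t within S)" for t S
    unfolding x_def y_def \<phi>_def
    by (rule has_field_derivative_at_within) (auto intro!: derivative_eq_intros I2_deriv)
  moreover have "loc_abs_cont_from (s - h) y"
    unfolding loc_abs_cont_from_def
  proof (intro allI impI)
    fix b
    obtain B where B: "0 \<le> B" "\<And>t. \<bar>apply_bcontfun z t\<bar> \<le> B" using bdd by blast
    define C where "C = P * (K + B) * exp (\<mu> * (b - s))"
    show "abs_cont_on (s - h) b y"
    proof (rule abs_cont_on_lipschitz[where B = C])
      fix u v assume uv: "s - h \<le> u" "u \<le> v" "v \<le> b"
      have "AE r in lebesgue. r \<in> {u..v} \<longrightarrow> \<bar>F z r\<bar> \<le> C"
        using F_le[OF B(2)]
      proof eventually_elim
        case (elim r)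
        show ?case
        proof
          assume "r \<in> {u..v}"
          then have "P * (K + B) * exp (\<mu> * (r - s)) \<le> C"
            unfolding C_def using uv \<mu> P_pos K B(1) by (intro mult_left_mono) auto
          with elim show "\<bar>F z r\<bar> \<le> C" by linarith
        qed
      qed
      from integrable_on_if_AE_le(2)[OF F_meas integrable_const_ivl this]
      show "\<bar>y v - y u\<bar> \<le> C * (v - u)"
        using integral_combine_left_zero[of "F z" s, OF F_int F_zero uv(2)] uv(2) unfolding y_def I1_def by (simp add: mult.commute)
    qed
  qed
  moreover have "AE t in lebesgue. t \<ge> s \<longrightarrow> (y has_real_derivative q t * x (t - \<tau> t)) (at t)"
  proof -
    \<comment> \<open>Differentiation of the integral is available for \<open>t > s\<close>, while
      the equation is demanded for \<open>t \<ge> s\<close>.\<close>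
    have "AE t in lebesgue. t \<noteq> s"
      by (rule AE_I'[of "{s}"]) auto
    then show ?thesis
      using AE_integral_has_real_derivative[OF F_int, of s z]
    proof eventually_elim
      case (elim t)
      show ?case
      proof
        assume "s \<le> t"
        then have "s < t" using elim by simp
        then have "(I1 z has_real_derivative F z t) (at t)"
          using elim unfolding I1_def by simp
        moreover have "F z t = q t * x (t - \<tau> t)"
          using \<open>s < t\<close> unfolding F_def x_def W_z by simp
        ultimately show "(y has_real_derivative q t * x (t - \<tau> t)) (at t)"
          unfolding y_def by (auto intro!: derivative_eq_intros)
      qed
    qed
  qed
  ultimately have "solves x y"
    unfolding solves_def by blast
  then show ?thesis
    using I1_zero I2_zero by (intro exI[of _ x] exI[of _ y]) (simp add: x_def y_def \<phi>_def)
qed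

end

subsection \<open>Existence of decaying solutions\<close>

locale decaying_comparison = delay_equation +
  fixes \<kappa> :: real
  assumes kappa_pos: "0 < \<kappa>" and kappa_h: "\<kappa> * h \<le> 2" and P_exp_le: "P * exp (\<kappa> * h) \<le> \<kappa>\<^sup>2"
begin

text \<open>The conditions on \<open>\<kappa>\<close> make \<open>exp (- \<kappa> t)\<close> a supersolution. With \<open>g t = x t * exp (\<kappa> (t - s))\<close>,
  \<open>k = defect x y\<close> is \<open>- g'\<close>; as long as \<open>x\<close> is nonnegative it satisfies
  \<open>k' \<ge> 2 \<kappa> k - \<kappa>\<^sup>2 (g (t - \<tau> t) - g t)\<close>, hence cannot drop below its nonnegative running maximum.\<close>

definition defect :: "(real \<Rightarrow> real) \<Rightarrow> (real \<Rightarrow> real) \<Rightarrow> real \<Rightarrow> real" where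
  "defect x y t = - (y t + \<kappa> * x t) * exp (\<kappa> * (t - s))"

lemma weighted_has_derivative:
  assumes "solves x y" "s - h \<le> t"
  shows "((\<lambda>t. x t * exp (\<kappa> * (t - s))) has_real_derivative - defect x y t) (at t within {s - h..})"
proof -
  have "(x has_real_derivative y t) (at t within {s - h..})"
    using assms by (auto simp: solves_def)
  then show ?thesis
    unfolding defect_def by (auto intro!: derivative_eq_intros simp: algebra_simps)
qed

lemma weighted_diff_le:
  assumes sol: "solves x y" and "s - h \<le> u" "u \<le> t" and le: "\<And>r. \<lbrakk>u \<le> r; r \<le> t\<rbrakk> \<Longrightarrow> defect x y r \<le> m"
  shows "x u * exp (\<kappa> * (u - s)) - x t * exp (\<kappa> * (t - s)) \<le> m * (t - u)"
proof -
  have 1: "((\<lambda>r. - defect x y r) has_integral x t * exp (\<kappa> * (t - s)) - x u * exp (\<kappa> * (u - s))) {u..t}"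
    using \<open>s - h \<le> u\<close>
    by (intro has_integral_real_derivative[OF \<open>u \<le> t\<close>] has_field_derivative_subset[OF weighted_has_derivative[OF sol]]) auto
  have 2: "((\<lambda>r. - m) has_integral - (m * (t - u))) {u..t}"
    using has_integral_const_real[of "- m" u t] \<open>u \<le> t\<close> by (simp add: mult.commute)
  show ?thesis
    using has_integral_le[OF 2 1] le by force
qed

lemma defect_continuous:
  assumes "solves x y" "s - h \<le> a"
  shows "continuous_on {a..b} (defect x y)"
  unfolding defect_def
  by (intro continuous_intros abs_cont_on_imp_continuous_on[OF solves_abs_cont[OF assms]]
      solves_continuous[OF assms])

text \<open>\<open>P_exp_le\<close> replaces the delayed coefficient by
  \<open>\<kappa>\<^sup>2\<close>. The remaining difference of \<open>g\<close> is the integral of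
  \<open>defect x y\<close> over the delay, at most \<open>m * h\<close>, and
  \<open>\<kappa>\<^sup>2 * h \<le> 2 * \<kappa>\<close> by \<open>kappa_h\<close>.\<close>

lemma weighted_force_le:
  assumes sol: "solves x y" and t: "s \<le> t" "0 \<le> \<tau> t" "\<tau> t \<le> h" "q t \<le> P" and "0 \<le> m"
    and nonneg: "0 \<le> x (t - \<tau> t)" and le: "\<And>r. \<lbrakk>s - h \<le> r; r \<le> t\<rbrakk> \<Longrightarrow> defect x y r \<le> m"
  shows "(q t * x (t - \<tau> t) - \<kappa>\<^sup>2 * x t) * exp (\<kappa> * (t - s)) \<le> 2 * \<kappa> * m"
proof -
  define g where "g = (\<lambda>t. x t * exp (\<kappa> * (t - s)))"
  have "q t * exp (\<kappa> * \<tau> t) \<le> P * exp (\<kappa> * h)"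
    using t q_nonneg[of t] kappa_pos P_pos by (intro mult_mono) auto
  then have "q t * exp (\<kappa> * \<tau> t) \<le> \<kappa>\<^sup>2"
    using P_exp_le by linarith
  then have "q t * exp (\<kappa> * \<tau> t) * g (t - \<tau> t) \<le> \<kappa>\<^sup>2 * g (t - \<tau> t)"
    using nonneg by (intro mult_right_mono) (simp_all add: g_def)
  moreover have "exp (\<kappa> * (t - s)) = exp (\<kappa> * \<tau> t) * exp (\<kappa> * (t - \<tau> t - s))"
    by (simp add: algebra_simps flip: exp_add)
  then have "q t * x (t - \<tau> t) * exp (\<kappa> * (t - s)) = q t * exp (\<kappa> * \<tau> t) * g (t - \<tau> t)"
    by (simp add: g_def)
  moreover have "(q t * x (t - \<tau> t) - \<kappa>\<^sup>2 * x t) * exp (\<kappa> * (t - s))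
      = q t * x (t - \<tau> t) * exp (\<kappa> * (t - s)) - \<kappa>\<^sup>2 * g t"
    by (simp only: g_def left_diff_distrib mult.assoc)
  ultimately have "(q t * x (t - \<tau> t) - \<kappa>\<^sup>2 * x t) * exp (\<kappa> * (t - s)) \<le> \<kappa>\<^sup>2 * (g (t - \<tau> t) - g t)"
    by (simp only: right_diff_distrib)
  also have "g (t - \<tau> t) - g t \<le> m * \<tau> t"
    unfolding g_def using weighted_diff_le[OF sol, of "t - \<tau> t" t m] t le by simp
  then have "\<kappa>\<^sup>2 * (g (t - \<tau> t) - g t) \<le> \<kappa>\<^sup>2 * (m * h)"
    using t \<open>0 \<le> m\<close> by (intro mult_left_mono) (auto intro: order_trans[OF _ mult_left_mono])
  also have "\<dots> = \<kappa> * m * (\<kappa> * h)"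
    by (simp add: power2_eq_square)
  also have "\<dots> \<le> \<kappa> * m * 2"
    using kappa_h kappa_pos \<open>0 \<le> m\<close> by (intro mult_left_mono) auto
  finally show ?thesis by (simp add: mult_ac)
qed

text \<open>By \<open>weighted_force_le\<close>, \<open>k' \<ge> 2 * \<kappa> * (k - m)\<close>
  a.e., where \<open>k\<close> is the defect and \<open>m\<close> its value at \<open>t0\<close>. So
  \<open>k - m\<close>, multiplied by the integrating factor \<open>e2\<close>, is nondecreasing
  from its value 0 at \<open>t0\<close>.\<close>

lemma defect_ge_maximum:
  assumes sol: "solves x y" and t0: "s \<le> t0" "t0 \<le> b"
    and nonneg: "\<And>t. \<lbrakk>s - h \<le> t; t \<le> b\<rbrakk> \<Longrightarrow> 0 \<le> x t"
    and "0 \<le> defect x y t0" and max: "\<And>t. \<lbrakk>s - h \<le> t; t \<le> b\<rbrakk> \<Longrightarrow> defect x y t \<le> defect x y t0"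
  shows "defect x y t0 \<le> defect x y b"
proof -
  define m where "m = defect x y t0"
  define e1 where "e1 = (\<lambda>t. exp (- \<kappa> * (t - s)))"
  define e2 where "e2 = (\<lambda>t. exp (- 2 * \<kappa> * (t - s)))"
  \<comment> \<open>\<open>E\<close> is \<open>(k - m) * e2\<close> written out in \<open>x\<close>
    and \<open>y\<close>, so that its absolute continuity follows from the closure rules.\<close>
  define E where "E = (\<lambda>t. - (m * e2 t + (y t + \<kappa> * x t) * e1 t))"
  have e: "e2 t = e1 t * e1 t" "e1 t * exp (\<kappa> * (t - s)) = 1" "0 < e1 t" for t
    by (auto simp: e1_def e2_def algebra_simps simp flip: exp_add)
  have E_eq: "E t = (defect x y t - m) * e2 t" for t
  proof -
    have "(defect x y t - m) * e2 t = - ((y t + \<kappa> * x t) * e1 t * (e1 t * exp (\<kappa> * (t - s)))) - m * e2 t"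
      unfolding defect_def e(1) by (simp add: algebra_simps)
    then show ?thesis unfolding e(2) E_def by simp
  qed
  have sh: "s - h \<le> t0" using t0 h_nonneg by linarith
  have "abs_cont_on t0 b x"
  proof (rule abs_cont_on_C1)
    show "continuous_on {t0..b} y"
      by (intro abs_cont_on_imp_continuous_on solves_abs_cont[OF sol sh])
    show "(x has_real_derivative y t) (at t within {t0..b})" if "t \<in> {t0..b}" for t
      using sol sh that unfolding solves_def
      by (auto intro!: has_field_derivative_subset[of x "y t" t "{s - h..}" "{t0..b}"])
  qed
  moreover have "abs_cont_on t0 b e1" "abs_cont_on t0 b e2"
    unfolding e1_def e2_def
    by (auto intro!: abs_cont_on_C1 derivative_eq_intros continuous_intros)
  ultimately have "abs_cont_on t0 b (\<lambda>t. - 1 * (m * e2 t + (y t + \<kappa> * x t) * e1 t))"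
    using solves_abs_cont[OF sol sh] by (intro abs_cont_on_cmult abs_cont_on_add abs_cont_on_mult)
  then have ac: "abs_cont_on t0 b E" by (simp add: E_def)
  define E' where "E' = (\<lambda>t. 2 * \<kappa> * m * e2 t - (q t * x (t - \<tau> t) - \<kappa>\<^sup>2 * x t) * e1 t)"
  have "AE t in lebesgue. t \<in> {t0..b} \<longrightarrow> (E has_real_derivative E' t) (at t)"
  proof -
    have "AE t in lebesgue. t \<ge> s \<longrightarrow> (y has_real_derivative q t * x (t - \<tau> t)) (at t)"
      using sol by (simp add: solves_def)
    moreover have "AE t in lebesgue. t \<noteq> s"
      by (rule AE_I'[of "{s}"]) auto
    ultimately show ?thesis
    proof eventually_elim
      case (elim t)
      show ?case
      proof
        assume "t \<in> {t0..b}"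
        then have "t > s" using elim t0 by auto
        then have "(x has_real_derivative y t) (at t)" "(y has_real_derivative q t * x (t - \<tau> t)) (at t)"
          using elim h_nonneg by (auto intro!: solves_has_derivative[OF sol])
        then show "(E has_real_derivative E' t) (at t)"
          unfolding E_def E'_def e1_def e2_def
          by (auto intro!: derivative_eq_intros simp: algebra_simps power2_eq_square)
      qed
    qed
  qed
  moreover have "AE t in lebesgue. t \<in> {t0..b} \<longrightarrow> 0 \<le> E' t"
    using tau_le q_le
  proof eventually_elim
    case (elim t)
    show ?case
    proof
      assume t: "t \<in> {t0..b}"
      have "(q t * x (t - \<tau> t) - \<kappa>\<^sup>2 * x t) * exp (\<kappa> * (t - s)) \<le> 2 * \<kappa> * m"
        using elim t t0 tau_nonneg[of t] assms(5) max
        by (intro weighted_force_le[OF sol] nonneg) (auto simp: m_def)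
      then have "(q t * x (t - \<tau> t) - \<kappa>\<^sup>2 * x t) * exp (\<kappa> * (t - s)) * e2 t \<le> 2 * \<kappa> * m * e2 t"
        using e by (intro mult_right_mono) (auto simp: less_imp_le)
      moreover have "exp (\<kappa> * (t - s)) * e2 t = e1 t"
        using e(2)[of t] unfolding e(1) by (simp add: mult_ac)
      ultimately show "0 \<le> E' t"
        unfolding E'_def mult.assoc[of _ "exp (\<kappa> * (t - s))" "e2 t"] by simp
    qed
  qed
  ultimately have "0 \<le> E b - E t0"
    using abs_cont_on_ge_integral[OF ac t0(2) _ has_integral_0] by blast
  moreover have "E t0 = 0" by (simp add: E_eq m_def)
  ultimately have "0 \<le> E b" by linarith
  then have "0 \<le> (defect x y b - m) * e2 b" unfolding E_eq .
  moreover have "0 < e2 b" by (simp add: e2_def)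
  ultimately show ?thesis
    by (simp add: m_def zero_le_mult_iff)
qed

text \<open>A maximum point at or after \<open>s\<close> reduces to
  \<open>defect_ge_maximum\<close>. If the maximum is attained before \<open>s\<close>, the initial
  condition makes it nonpositive, so \<open>t0\<close> is a maximum point itself.\<close>

lemma defect_ge:
  assumes sol: "solves x y" and t0: "s \<le> t0" "t0 \<le> b"
    and nonneg: "\<And>t. \<lbrakk>s - h \<le> t; t \<le> b\<rbrakk> \<Longrightarrow> 0 \<le> x t"
    and init: "\<And>t. \<lbrakk>s - h \<le> t; t \<le> s\<rbrakk> \<Longrightarrow> defect x y t \<le> 0"
    and "0 \<le> defect x y t0"
  shows "defect x y t0 \<le> defect x y b"
proof -
  have "s - h \<le> b" using t0 h_nonneg by linarith
  then obtain t1 where t1: "t1 \<in> {s - h..b}" "\<And>t. t \<in> {s - h..b} \<Longrightarrow> defect x y t \<le> defect x y t1"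
    using continuous_attains_sup[of "{s - h..b}" "defect x y"] defect_continuous[OF sol] by fastforce
  have t01: "defect x y t0 \<le> defect x y t1"
    using t1 t0 h_nonneg by auto
  show ?thesis
  proof (cases "s \<le> t1")
    case True
    have "defect x y t1 \<le> defect x y b"
      by (rule defect_ge_maximum[OF sol True _ nonneg]) (use t1 t01 \<open>0 \<le> defect x y t0\<close> in auto)
    with t01 show ?thesis by linarith
  next
    case False
    then have "defect x y t1 \<le> defect x y t0"
      using init[of t1] t1(1) \<open>0 \<le> defect x y t0\<close> by auto
    then have "defect x y t \<le> defect x y t0" if "s - h \<le> t" "t \<le> b" for t
      using t1(2)[of t] that by simp
    then show ?thesis
      using defect_ge_maximum[OF sol t0 nonneg \<open>0 \<le> defect x y t0\<close>] by blast
  qed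
qed

text \<open>A shooting argument over the initial slopes \<open>- c\<close>, \<open>0 \<le> c \<le> \<kappa>\<close>, of linear initial functions:
  the least slope for which positivity fails would produce a solution with a double zero, whereas
  a solution going to infinity stays positive under a small change of the slope.\<close>

theorem ex_monotone_decaying_solution: "\<exists>x y. solves x y \<and> exhibits x Monotone_Decay"
proof -
  obtain x1 y1 where x1: "solves x1 y1" "\<And>t. t \<le> s \<Longrightarrow> x1 t = 1" "\<And>t. t \<le> s \<Longrightarrow> y1 t = 0"
    using initial_value_problem_solvable[of 1 0] by auto
  obtain x2 y2 where x2: "solves x2 y2" "\<And>t. t \<le> s \<Longrightarrow> x2 t = t - s" "\<And>t. t \<le> s \<Longrightarrow> y2 t = 1"
    using initial_value_problem_solvable[of 0 1] by auto
  define x where "x = (\<lambda>c t. x1 t - c * x2 t)"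
  define y where "y = (\<lambda>c t. y1 t - c * y2 t)"
  have sol: "solves (x c) (y c)" for c
    using solves_lincomb[OF x1(1) x2(1), of 1 "- c"] by (simp add: x_def y_def)
  have x_init: "x c t = 1 - c * (t - s)" "y c t = - c" if "t \<le> s" for c t
    using that x1 x2 by (auto simp: x_def y_def)
  have x_init_pos: "0 < x c t" if "0 \<le> c" "t \<le> s" for c t
  proof -
    have "c * (t - s) \<le> 0" using that by (intro mult_nonneg_nonpos) auto
    then show ?thesis using x_init that by simp
  qed
  \<comment> \<open>Here \<open>c \<le> \<kappa>\<close> enters: for \<open>t \<le> s\<close> the
    solution is at least 1, so \<open>y c t + \<kappa> * x c t \<ge> \<kappa> - c\<close>.\<close>
  have defect_init: "defect (x c) (y c) t \<le> 0" if "0 \<le> c" "c \<le> \<kappa>" "t \<le> s" for c t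
  proof -
    have "c * (t - s) \<le> 0" using that by (intro mult_nonneg_nonpos) auto
    then have "\<kappa> * 1 \<le> \<kappa> * (1 - c * (t - s))" using kappa_pos by (intro mult_left_mono) auto
    then have "0 \<le> y c t + \<kappa> * x c t"
      using that by (simp add: x_init)
    then show ?thesis
      unfolding defect_def by (simp add: mult_nonpos_nonneg)
  qed
  \<comment> \<open>A zero of a nonnegative solution is a minimum, so \<open>y\<close> and the
    defect vanish there. But the weighted solution has fallen from 1 to 0, so the defect was
    positive earlier, and \<open>defect_ge\<close> keeps it positive.\<close>
  have no_double_zero: "0 < x c t"
    if c: "0 \<le> c" "c \<le> \<kappa>" and nonneg: "\<And>t. s \<le> t \<Longrightarrow> 0 \<le> x c t" and t: "s \<le> t" for c t
  proof (rule ccontr)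
    assume "\<not> 0 < x c t"
    with nonneg[OF t] have zero: "x c t = 0" by simp
    have nonneg': "0 \<le> x c r" for r
      using nonneg[of r] x_init_pos[OF c(1), of r] by (cases "s \<le> r") auto
    have "s < t" using t zero x_init_pos[OF c(1), of s] by (cases "s = t") auto
    then have "(x c has_real_derivative y c t) (at t)"
      using h_nonneg by (intro solves_has_derivative[OF sol]) auto
    then have "y c t = 0"
      using DERIV_local_min[of "x c" "y c t" t 1] nonneg' zero by auto
    then have d0: "defect (x c) (y c) t = 0" by (simp add: defect_def zero)
    have "\<exists>r. s \<le> r \<and> r \<le> t \<and> 0 < defect (x c) (y c) r"
    proof (rule ccontr)
      assume "\<nexists>r. s \<le> r \<and> r \<le> t \<and> 0 < defect (x c) (y c) r"
      then have "x c s * exp (\<kappa> * (s - s)) - x c t * exp (\<kappa> * (t - s)) \<le> 0 * (t - s)"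
        using t h_nonneg by (intro weighted_diff_le[OF sol]) (auto simp: not_less)
      then show False using zero x_init[of s c] by simp
    qed
    then obtain r where "s \<le> r" "r \<le> t" "0 < defect (x c) (y c) r" by blast
    then show False
      using defect_ge[OF sol, of r t c] nonneg' defect_init[OF c] d0 by force
  qed
  define S where "S = {c \<in> {0..\<kappa>}. \<exists>t\<ge>s. x c t \<le> 0}"
  show ?thesis
  proof (cases "S = {}")
    case True
    then have "\<forall>c\<in>{0..\<kappa>}. \<forall>t\<ge>s. \<not> x c t \<le> 0"
      unfolding S_def by blast
    then have pos: "0 < x \<kappa> t" if "s \<le> t" for t
      using that kappa_pos by (auto simp: not_le)
    have pos': "0 < x \<kappa> t" for t
      using pos[of t] x_init_pos[of \<kappa> t] kappa_pos by (cases "s \<le> t") auto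
    \<comment> \<open>For slope \<open>- \<kappa>\<close> the defect is 0 at \<open>s\<close> and
      stays nonnegative, so the solution decreases and cannot go to infinity.\<close>
    have le1: "x \<kappa> t \<le> 1" if t: "s \<le> t" for t
    proof -
      have "y \<kappa> r \<le> 0" if "r \<in> {s..t}" for r
      proof -
        have "defect (x \<kappa>) (y \<kappa>) s = 0" by (simp add: defect_def x_init)
        then have "0 \<le> defect (x \<kappa>) (y \<kappa>) r"
          using defect_ge[OF sol, of s r \<kappa>] that pos' defect_init[of \<kappa>] kappa_pos by (force simp: less_imp_le)
        then have "y \<kappa> r + \<kappa> * x \<kappa> r \<le> 0"
          unfolding defect_def by (simp add: zero_le_mult_iff)
        moreover have "0 < \<kappa> * x \<kappa> r" using pos' kappa_pos by simp
        ultimately show ?thesis by linarith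
      qed
      then have "x \<kappa> t \<le> x \<kappa> s"
        using t h_nonneg by (intro solves_antimono[OF sol]) auto
      then show ?thesis by (simp add: x_init)
    qed
    have "\<not> filterlim (x \<kappa>) at_top at_top"
    proof
      assume "filterlim (x \<kappa>) at_top at_top"
      then have "\<forall>\<^sub>F t in at_top. 1 < x \<kappa> t" by (simp add: filterlim_at_top_dense)
      then obtain t where "s \<le> t" "1 < x \<kappa> t"
        using eventually_happens'[OF trivial_limit_at_top_linorder eventually_conj[OF _ eventually_ge_at_top[of s]]]
        by blast
      then show False using le1[of t] by simp
    qed
    then have "\<not> exhibits (x \<kappa>) To_Plus_Infinity" by simp
    then show ?thesis
      using eventually_positive_solution_behaviour[OF sol pos] sol by blast
  next
    case False
    define d where "d = Inf S"
    have bdd: "bdd_below S" by (auto simp: S_def bdd_below_def)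
    have d: "0 \<le> d" "d \<le> \<kappa>"
      unfolding d_def using False bdd by (auto simp: S_def intro!: cInf_greatest intro: cInf_lower2)
    have below: "0 < x c t" if "0 \<le> c" "c < d" "s \<le> t" for c t
    proof (rule ccontr)
      assume "\<not> 0 < x c t"
      then have "c \<in> S" using that d by (auto simp: S_def not_less)
      then show False using cInf_lower[OF _ bdd, of c] that unfolding d_def by simp
    qed
    have x1_pos: "0 < x1 t" if "s \<le> t" for t
      by (rule solves_stays_positive[OF x1(1) order_refl _ _ that]) (simp_all add: x1)
    \<comment> \<open>If \<open>x d\<close> were negative at \<open>t\<close>, the slope parameter
      \<open>x1 t / x2 t\<close> would lie below \<open>d\<close> and already produce a zero at
      \<open>t\<close>.\<close>
    have nonneg: "0 \<le> x d t" if t: "s \<le> t" for t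
    proof (rule ccontr)
      assume "\<not> 0 \<le> x d t"
      then have *: "x1 t < d * x2 t" by (simp add: x_def)
      have "0 < d * x2 t" using * x1_pos[OF t] by linarith
      then have "0 < x2 t" using d(1) by (simp add: zero_less_mult_iff)
      then have "0 \<le> x1 t / x2 t" "x1 t / x2 t < d" "x (x1 t / x2 t) t = 0"
        using * x1_pos[OF t] by (auto simp: x_def pos_divide_less_eq)
      then show False using below[OF _ _ t] by force
    qed
    have pos: "0 < x d t" if "s \<le> t" for t
      using no_double_zero[OF d nonneg that] .
    consider "exhibits (x d) Monotone_Decay" | "exhibits (x d) To_Plus_Infinity"
      using eventually_positive_solution_behaviour[OF sol pos] by blast
    then show ?thesis
    proof cases
      case 2
      then have "\<forall>\<^sub>F t in at_top. 0 < deriv (x d) t"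
        by (simp add: filterlim_at_top_dense)
      then have "\<forall>\<^sub>F t in at_top. s \<le> t \<and> 0 < y d t"
        using eventually_deriv_eq[OF sol, of d] eventually_ge_at_top[of s] by eventually_elim simp
      then obtain t0 where t0: "s \<le> t0" "0 < y d t0"
        using eventually_happens'[OF trivial_limit_at_top_linorder] by blast
      have cont: "continuous_on {s..t0} f" if "solves f f'" for f f'
        using h_nonneg by (intro solves_continuous[OF that]) linarith
      obtain r where r: "r \<in> {s..t0}" "\<And>t. t \<in> {s..t0} \<Longrightarrow> x d r \<le> x d t"
        using continuous_attains_inf[of "{s..t0}" "x d"] cont[OF sol] t0 by fastforce
      \<comment> \<open>\<open>m\<close> is the margin of positivity of the solution on
        \<open>{s..t0}\<close> and of its slope at \<open>t0\<close>. A parameter \<open>c\<close>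
        within \<open>m / B'\<close> of \<open>d\<close> preserves both, so \<open>x c\<close> stays
        positive, contradicting \<open>c \<in> S\<close>.\<close>
      define m where "m = min (x d r) (y d t0)"
      have "0 < m" using pos[of r] r(1) t0 by (auto simp: m_def)
      obtain B where B: "\<And>t. t \<in> {s..t0} \<Longrightarrow> \<bar>x2 t\<bar> \<le> B"
        using compact_imp_bounded[OF compact_continuous_image[OF cont[OF x2(1)] compact_Icc]]
        unfolding bounded_iff by (metis image_eqI real_norm_def)
      define B' where "B' = \<bar>B\<bar> + \<bar>y2 t0\<bar> + 1"
      have "0 < B'" by (simp add: B'_def)
      have "\<exists>c\<in>S. c < d + m / B'"
        using cInf_lessD[OF False, of "d + m / B'"] \<open>0 < m\<close> \<open>0 < B'\<close> unfolding d_def by auto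
      then obtain c where c: "c \<in> S" "c < d + m / B'" by blast
      have "d \<le> c" "0 \<le> c" using cInf_lower[OF c(1) bdd] c(1) by (auto simp: d_def S_def)
      have small: "(c - d) * v < m" if "\<bar>v\<bar> < B'" for v
      proof -
        have "(c - d) * v \<le> (c - d) * \<bar>v\<bar>"
          using \<open>d \<le> c\<close> by (intro mult_left_mono) auto
        also have "\<dots> \<le> (c - d) * B'"
          using \<open>d \<le> c\<close> that by (intro mult_left_mono) auto
        also have "\<dots> < m"
          using c(2) \<open>0 < B'\<close> by (simp add: field_simps)
        finally show ?thesis .
      qed
      have x_c: "x c t = x d t - (c - d) * x2 t" "y c t = y d t - (c - d) * y2 t" for t
        by (auto simp: x_def y_def algebra_simps)
      have pos_c: "0 < x c t" if "t \<le> t0" for t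
      proof (cases "s \<le> t")
        case True
        have "\<bar>x2 t\<bar> < B'" using B[of t] True that by (auto simp: B'_def)
        then have "(c - d) * x2 t < x d t"
          using small[of "x2 t"] r(2)[of t] True that by (simp add: m_def)
        then show ?thesis by (simp add: x_c)
      qed (use x_init_pos[OF \<open>0 \<le> c\<close>] in simp)
      have "0 < y c t0"
        using small[of "y2 t0"] by (simp add: x_c m_def B'_def)
      have "0 < x c t" if "t0 \<le> t" for t
        by (rule solves_stays_positive[OF sol t0(1) pos_c _ that]) (use \<open>0 < y c t0\<close> in auto)
      then have "0 < x c t" for t
        using pos_c[of t] by (cases "t \<le> t0") auto
      moreover obtain t where "x c t \<le> 0"
        using c(1) unfolding S_def by blast
      ultimately show ?thesis
        by (meson not_le)
    qed (use sol in blast)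
  qed
qed

end

subsection \<open>Asymptotic behaviour of all solutions\<close>

text \<open>\<open>real_of_ereal\<close> sends both infinities to 0. Essential boundedness excludes
  a supremum of infinity, and a supremum of minus infinity means that almost no point lies in
  \<open>S\<close>.\<close>

lemma AE_le_ess_sup_on:
  assumes S: "S \<in> sets lebesgue" and f: "f \<in> borel_measurable lebesgue" and "ess_bounded f"
  shows "AE t in lebesgue. t \<in> S \<longrightarrow> f t \<le> ess_sup_on S f"
proof -
  define c where "c = esssup lebesgue (\<lambda>t. ereal \<bar>f t\<bar>)"
  define d where "d = esssup (lebesgue_on S) (\<lambda>t. ereal (f t))"
  have "c < \<infinity>" using assms(3) by (simp add: ess_bounded_def c_def)
  have "AE t in lebesgue. ereal \<bar>f t\<bar> \<le> c"
    unfolding c_def by (rule esssup_AE)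
  then have "AE t in lebesgue. t \<in> S \<longrightarrow> ereal (f t) \<le> c"
    by eventually_elim (metis abs_ge_self ereal_less_eq(3) order_trans)
  then have "AE t in lebesgue_on S. ereal (f t) \<le> c"
    using S by (subst AE_restrict_space_iff) auto
  moreover have "f \<in> borel_measurable (lebesgue_on S)"
    using f by (rule measurable_restrict_space1)
  ultimately have "d \<le> c"
    unfolding d_def by (intro esssup_I) auto
  then have "d < \<infinity>" using \<open>c < \<infinity>\<close> by (rule le_less_trans)
  have "AE t in lebesgue_on S. ereal (f t) \<le> d"
    unfolding d_def by (rule esssup_AE)
  then have "AE t in lebesgue. t \<in> S \<longrightarrow> ereal (f t) \<le> d"
    using S by (subst (asm) AE_restrict_space_iff) auto
  then show ?thesis
  proof eventually_elim
    case (elim t)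
    then show ?case
      using \<open>d < \<infinity>\<close> unfolding ess_sup_on_def d_def[symmetric] by (cases d) auto
  qed
qed

text \<open>A half-line is not a null set. This provides one time with
  \<open>\<tau> t \<le> h\<close>, whence \<open>0 \<le> h\<close>.\<close>

lemma AE_lebesgue_atLeast_obtains:
  fixes s :: real
  assumes "AE t in lebesgue. t \<ge> s \<longrightarrow> Q t"
  obtains t where "t \<ge> s" "Q t"
proof -
  have "\<exists>t\<ge>s. Q t"
  proof (rule ccontr)
    assume "\<not> (\<exists>t\<ge>s. Q t)"
    then have "AE t \<in> {s<..} in lebesgue. t \<in> {}"
      using assms by (auto elim: eventually_mono)
    then have "s + 1 \<in> ({} :: real set)"
      by (rule mem_closed_if_AE_lebesgue_open[rotated 2]) auto
    then show False by simp
  qed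
  with that show thesis by blast
qed

text \<open>If the integrals from \<open>T\<close> stayed below \<open>C\<close>, monotone
  convergence along growing intervals would make the integral over \<open>{0..}\<close>
  finite.\<close>

lemma integral_unbounded_if_nn_integral_infinite:
  fixes q :: "real \<Rightarrow> real"
  assumes q: "q \<in> borel_measurable lebesgue" "\<And>t. 0 \<le> q t" and int: "\<And>a b. q integrable_on {a..b}"
    and inf: "(\<integral>\<^sup>+t\<in>{0..}. ennreal (q t) \<partial>lebesgue) = \<infinity>"
  shows "\<exists>b\<ge>T. C \<le> integral {T..b} q"
proof (rule ccontr)
  assume "\<not> ?thesis"
  then have less: "integral {T..b} q < C" if "T \<le> b" for b
    using that by (meson not_le)
  \<comment> \<open>Starting at \<open>min T 0\<close> makes the intervals exhaust
    \<open>{0..}\<close> even when \<open>T\<close> is positive.\<close>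
  define a where "a = min T 0"
  define D where "D = integral {a..T} q + \<bar>C\<bar>"
  have le: "integral {a..b} q \<le> D" if "T \<le> b" for b
    using Henstock_Kurzweil_Integration.integral_combine[of a T b q] that less[OF that] int
    by (simp add: a_def D_def)
  have "(\<integral>\<^sup>+t. ennreal (q t) * indicator {0..} t \<partial>lebesgue) \<le> ennreal D"
  proof -
    have "(\<integral>\<^sup>+t. ennreal (q t) * indicator {0..} t \<partial>lebesgue) \<le> (\<integral>\<^sup>+t. (SUP n. ennreal (q t) * indicator {a..T + real n} t) \<partial>lebesgue)"
    proof (rule nn_integral_mono)
      fix t
      show "ennreal (q t) * indicator {0..} t \<le> (SUP n. ennreal (q t) * indicator {a..T + real n} t)"
      proof (cases "0 \<le> t")
        case True
        obtain n where "t - T \<le> real n" using real_arch_simple by blast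
        then have "t \<in> {a..T + real n}" using True by (auto simp: a_def)
        then show ?thesis
          by (intro SUP_upper2[of n]) (auto simp: indicator_def)
      qed simp
    qed
    also have "\<dots> = (SUP n. \<integral>\<^sup>+t. ennreal (q t) * indicator {a..T + real n} t \<partial>lebesgue)"
    proof (rule nn_integral_monotone_convergence_SUP)
      show "incseq (\<lambda>n t. ennreal (q t) * indicator {a..T + real n} t)"
        by (auto simp: incseq_def le_fun_def intro!: mult_left_mono indicator_leI)
      show "(\<lambda>t. ennreal (q t) * indicator {a..T + real n} t) \<in> borel_measurable lebesgue" for n
        using q(1) by (intro borel_measurable_times_ennreal borel_measurable_indicator
            measurable_compose[OF _ measurable_ennreal]) auto
    qed
    also have "\<dots> \<le> ennreal D"
    proof (rule SUP_least)
      fix n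
      have "(\<integral>\<^sup>+t. ennreal (q t) * indicator {a..T + real n} t \<partial>lebesgue) = ennreal (integral {a..T + real n} q)"
        using nn_integral_has_integral_lebesgue'[OF q(2) integrable_integral[OF int]]
        by (simp add: nn_integral_completion)
      also have "\<dots> \<le> ennreal D"
        by (intro ennreal_leI le) simp
      finally show "(\<integral>\<^sup>+t. ennreal (q t) * indicator {a..T + real n} t \<partial>lebesgue) \<le> ennreal D" .
    qed
    finally show ?thesis .
  qed
  then show False using inf by (simp add: top_unique)
qed

lemma exhibits_unique:
  assumes "exhibits x b" "exhibits x b'"
  shows "b = b'"
proof -
  have bot: "at_top \<noteq> (bot :: real filter)" by (rule trivial_limit_at_top_linorder)
  have *: "\<not> filterlim x at_top at_top" "\<not> filterlim x at_bot at_top" if "(x \<longlongrightarrow> 0) at_top"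
    using that not_tendsto_and_filterlim_at_infinity[OF bot that]
    by (auto dest: filterlim_at_top_imp_at_infinity filterlim_at_bot_imp_at_infinity)
  have **: "\<not> (filterlim x at_top at_top \<and> filterlim x at_bot at_top)"
  proof
    assume "filterlim x at_top at_top \<and> filterlim x at_bot at_top"
    then have "\<forall>\<^sub>F t in at_top. 0 < x t" "\<forall>\<^sub>F t in at_top. x t < 0"
      by (auto simp: filterlim_at_top_dense filterlim_at_bot_dense)
    then have "\<forall>\<^sub>F t::real in at_top. False" by eventually_elim simp
    then show False by simp
  qed
  show ?thesis
    using assms * ** by (cases b; cases b') auto
qed

text \<open>\<open>deriv\<close> commutes with negation where \<open>x\<close> is differentiable,
  which for a solution is known eventually; hence the hypothesis \<open>der\<close>.\<close>

lemma exhibits_uminus: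
  assumes der: "\<forall>\<^sub>F t in at_top. deriv (\<lambda>t. - x t) t = - deriv x t"
  shows "exhibits (\<lambda>t. - x t) Monotone_Decay \<Longrightarrow> exhibits x Monotone_Decay"
    and "exhibits (\<lambda>t. - x t) To_Plus_Infinity \<Longrightarrow> exhibits x To_Minus_Infinity"
proof -
  assume "exhibits (\<lambda>t. - x t) Monotone_Decay"
  then have "\<not> oscillatory x" and mono: "eventually_monotone (\<lambda>t. - x t)"
    and "((\<lambda>t. - x t) \<longlongrightarrow> 0) at_top" "(deriv (\<lambda>t. - x t) \<longlongrightarrow> 0) at_top"
    by (auto simp: oscillatory_def)
  moreover have "((\<lambda>t. - deriv x t) \<longlongrightarrow> 0) at_top"
    using calculation(4) filterlim_cong[OF refl refl der] by blast
  moreover have "eventually_monotone x"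
    using mono unfolding eventually_monotone_def monotone_on_def by auto
  ultimately show "exhibits x Monotone_Decay"
    using tendsto_minus_cancel_left[of x 0 at_top] tendsto_minus_cancel_left[of "deriv x" 0 at_top] by simp
next
  assume "exhibits (\<lambda>t. - x t) To_Plus_Infinity"
  then have "filterlim (\<lambda>t. - x t) at_top at_top" "filterlim (\<lambda>t. - deriv x t) at_top at_top"
    using filterlim_cong[OF refl refl der, of at_top] by auto
  then show "exhibits x To_Minus_Infinity"
    by (simp add: filterlim_uminus_at_bot)
qed

section \<open>Every solution exhibits one of the behaviours\<close>

context short_delay
begin

theorem solution_behaviour:
  assumes sol: "solves x y"
  shows "\<exists>b. exhibits x b"
proof (cases "oscillatory x")
  case True
  then have "exhibits x Oscillatory_Decay"
    using oscillatory_solution_tendsto_zero[OF sol] by simp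
  then show ?thesis ..
next
  case False
  then obtain T where T: "\<And>t. T \<le> t \<Longrightarrow> x t \<noteq> 0"
    unfolding oscillatory_def by blast
  define T0 where "T0 = max T s"
  have nz: "x t \<noteq> 0" if "T0 \<le> t" for t using T that by (simp add: T0_def)
  have cont: "continuous_on {a..b} x" if "T0 \<le> a" for a b
    using that h_nonneg by (intro solves_continuous[OF sol]) (simp add: T0_def)
  show ?thesis
  proof (cases "0 < x T0")
    case True
    have "0 < x t" if t: "T0 \<le> t" for t
    proof (rule ccontr)
      assume "\<not> 0 < x t"
      then obtain r where "T0 \<le> r" "x r = 0"
        using IVT2'[of x t 0 T0] True t cont[of T0 t] by (auto simp: not_less)
      then show False using nz by blast
    qed
    then show ?thesis
      using eventually_positive_solution_behaviour[OF sol] by blast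
  next
    case False
    then have "x T0 < 0" using nz[of T0] by simp
    have "0 < - x t" if t: "T0 \<le> t" for t
    proof (rule ccontr)
      assume "\<not> 0 < - x t"
      then obtain r where "T0 \<le> r" "x r = 0"
        using IVT'[of x T0 0 t] \<open>x T0 < 0\<close> t cont[of T0 t] by (auto simp: not_less)
      then show False using nz by blast
    qed
    then have "exhibits (\<lambda>t. - x t) Monotone_Decay \<or> exhibits (\<lambda>t. - x t) To_Plus_Infinity"
      by (rule eventually_positive_solution_behaviour[OF solves_uminus[OF sol]])
    moreover have "\<forall>\<^sub>F t in at_top. deriv (\<lambda>t. - x t) t = - deriv x t"
      using eventually_deriv_eq[OF sol] eventually_deriv_eq[OF solves_uminus[OF sol]]
      by eventually_elim simp
    ultimately show ?thesis
      using exhibits_uminus by blast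
  qed
qed

end

text \<open>\<open>\<kappa> = 2 / h\<close> maximises
  \<open>\<kappa>\<^sup>2 * exp (- \<kappa> * h)\<close>, and the hypothesis says exactly that
  \<open>P\<close> is at most this maximum. Without delay the condition reduces to
  \<open>P \<le> \<kappa>\<^sup>2\<close>.\<close>

lemma (in delay_equation) ex_decay_rate:
  assumes le: "h * sqrt P \<le> 2 / exp 1"
  obtains \<kappa> where "0 < \<kappa>" "\<kappa> * h \<le> 2" "P * exp (\<kappa> * h) \<le> \<kappa>\<^sup>2"
proof (cases "h = 0")
  case True
  then show thesis
    using P_pos by (intro that[of "sqrt P"]) auto
next
  case False
  then have "0 < h" using h_nonneg by simp
  have "(h * sqrt P)\<^sup>2 \<le> (2 / exp 1)\<^sup>2"
    using le h_nonneg P_pos by (intro power_mono) auto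
  then have "h\<^sup>2 * P \<le> 4 / exp 2"
    using P_pos by (simp add: power_mult_distrib power_divide flip: exp_of_nat_mult)
  then have "P * exp 2 \<le> (2 / h)\<^sup>2"
    using \<open>0 < h\<close> by (simp add: power_divide field_simps)
  then show thesis
    using \<open>0 < h\<close> by (intro that[of "2 / h"]) auto
qed

theorem corollary22:
  fixes p \<tau> :: "real \<Rightarrow> real" and s \<gamma> :: real
  assumes p_meas: "p \<in> borel_measurable lebesgue"
    and p_bdd: "ess_bounded p"
    and tau_meas: "\<tau> \<in> borel_measurable lebesgue"
    and tau_bdd: "ess_bounded \<tau>"
    and tau_nonneg: "\<And>t. 0 \<le> \<tau> t"
    and p_nonpos: "\<And>t. p t \<le> 0"
    and p_div: "(\<integral>\<^sup>+t\<in>{0..}. ennreal \<bar>p t\<bar> \<partial>lebesgue) = \<infinity>"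
    and gamma_range: "\<gamma> \<in> {sqrt 2..pi/2}"
    and gamma_eq: "Psi 1 \<gamma> = \<gamma>"
    and small: "max_delay \<tau> s * sqrt (ess_sup_on UNIV (\<lambda>t. \<bar>p t\<bar>)) < \<gamma>"
  shows "(\<forall>x. is_solution p \<tau> s x \<longrightarrow> (\<exists>!b. exhibits x b)) \<and>
    (max_delay \<tau> s * sqrt (ess_sup_on UNIV (\<lambda>t. \<bar>p t\<bar>)) \<le> 2 / exp 1 \<longrightarrow>
      (\<exists>x. is_solution p \<tau> s x \<and> exhibits x Monotone_Decay))"
proof -
  define q where "q = (\<lambda>t. \<bar>p t\<bar>)"
  define h where "h = max_delay \<tau> s"
  define P where "P = ess_sup_on UNIV q"
  have q_meas: "q \<in> borel_measurable lebesgue"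
    unfolding q_def using p_meas by (rule borel_measurable_abs)
  have q_nonneg: "0 \<le> q t" for t by (simp add: q_def)
  have "ess_bounded q" using p_bdd by (simp add: ess_bounded_def q_def)
  then have q_le: "AE t in lebesgue. q t \<le> P"
    unfolding P_def using AE_le_ess_sup_on[OF _ q_meas, of UNIV] by simp
  have tau_le: "AE t in lebesgue. t \<ge> s \<longrightarrow> \<tau> t \<le> h"
    unfolding h_def max_delay_def using AE_le_ess_sup_on[OF _ tau_meas tau_bdd, of "{s..}"] by simp
  have "0 \<le> h"
    using AE_lebesgue_atLeast_obtains[OF tau_le] tau_nonneg by (metis order_trans)
  \<comment> \<open>Otherwise \<open>p\<close> would vanish a.e., against the divergence of its
    integral.\<close>
  have "0 < P"
  proof (rule ccontr)
    assume "\<not> 0 < P"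
    then have "AE t in lebesgue. ennreal (q t) * indicator {0..} t = 0"
      using q_le by (auto elim!: eventually_mono simp: ennreal_neg)
    then have "(\<integral>\<^sup>+t\<in>{0..}. ennreal (q t) \<partial>lebesgue) = nn_integral lebesgue (\<lambda>t::real. 0)"
      by (rule nn_integral_cong_AE)
    then show False using p_div by (simp add: q_def)
  qed
  have q_int: "q integrable_on {a..b}" for a b
    using q_le q_nonneg by (intro integrable_on_if_AE_le(1)[OF q_meas integrable_const_ivl[of P]])
      (auto elim: eventually_mono)
  have unbounded: "\<exists>b\<ge>T. C \<le> integral {T..b} q" for C T
    using p_div by (intro integral_unbounded_if_nn_integral_infinite[OF q_meas q_nonneg q_int]) (simp add: q_def)
  have "h * sqrt P < 8 / 5"
    using small gamma_range pi_less_16_5 unfolding h_def P_def q_def by simp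
  then interpret short_delay q \<tau> s h P
    using q_meas tau_meas q_nonneg q_le \<open>0 < P\<close> tau_nonneg tau_le \<open>0 \<le> h\<close> unbounded
    by unfold_locales
  \<comment> \<open>As \<open>p \<le> 0\<close>, \<open>q = - p\<close>; the equation determines the
    a.e. second derivative, so both notions describe the same functions.\<close>
  have solution_iff: "is_solution p \<tau> s x \<longleftrightarrow> (\<exists>y. solves x y)" for x
  proof
    assume "is_solution p \<tau> s x"
    then obtain y where y: "\<forall>t\<ge>s - h. (x has_real_derivative y t) (at t within {s - h..})"
      "loc_abs_cont_from (s - h) y"
      "AE t in lebesgue. t \<ge> s \<longrightarrow> (\<exists>z. (y has_real_derivative z) (at t) \<and> z + p t * x (t - \<tau> t) = 0)"
      unfolding is_solution_def Let_def h_def by blast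
    have "AE t in lebesgue. t \<ge> s \<longrightarrow> (y has_real_derivative q t * x (t - \<tau> t)) (at t)"
      using y(3)
    proof eventually_elim
      case (elim t)
      have "z = q t * x (t - \<tau> t)" if "z + p t * x (t - \<tau> t) = 0" for z
        using that p_nonpos[of t] by (simp add: q_def)
      with elim show ?case by metis
    qed
    with y show "\<exists>y. solves x y" unfolding solves_def by blast
  next
    assume "\<exists>y. solves x y"
    then obtain y where sol: "solves x y" by blast
    have "abs_cont_on (s - h) b x" for b
    proof (rule abs_cont_on_C1)
      show "continuous_on {s - h..b} y"
        by (intro abs_cont_on_imp_continuous_on solves_abs_cont[OF sol order_refl])
      show "(x has_real_derivative y t) (at t within {s - h..b})" if "t \<in> {s - h..b}" for t
        using sol that unfolding solves_def
        by (auto intro!: has_field_derivative_subset[of x "y t" t "{s - h..}" "{s - h..b}"])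
    qed
    moreover have "AE t in lebesgue. t \<ge> s \<longrightarrow> (\<exists>z. (y has_real_derivative z) (at t) \<and> z + p t * x (t - \<tau> t) = 0)"
    proof -
      have "AE t in lebesgue. t \<ge> s \<longrightarrow> (y has_real_derivative q t * x (t - \<tau> t)) (at t)"
        using sol by (simp add: solves_def)
      then show ?thesis
      proof eventually_elim
        case (elim t)
        have "q t * x (t - \<tau> t) + p t * x (t - \<tau> t) = 0"
          using p_nonpos[of t] by (simp add: q_def)
        with elim show ?case by blast
      qed
    qed
    ultimately show "is_solution p \<tau> s x"
      using sol unfolding is_solution_def Let_def h_def[symmetric] solves_def loc_abs_cont_from_def by blast
  qed
  have "\<exists>!b. exhibits x b" if x: "is_solution p \<tau> s x" for x
  proof -
    obtain y where "solves x y" using x unfolding solution_iff by blast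
    then obtain b where "exhibits x b" using solution_behaviour by blast
    then show ?thesis by (intro ex1I[of _ b] exhibits_unique)
  qed
  moreover have "\<exists>x. is_solution p \<tau> s x \<and> exhibits x Monotone_Decay" if le: "h * sqrt P \<le> 2 / exp 1"
  proof -
    obtain \<kappa> where "0 < \<kappa>" "\<kappa> * h \<le> 2" "P * exp (\<kappa> * h) \<le> \<kappa>\<^sup>2"
      using ex_decay_rate[OF le] .
    then interpret decaying_comparison q \<tau> s h P \<kappa>
      by unfold_locales
    show ?thesis
      using ex_monotone_decaying_solution unfolding solution_iff by blast
  qed
  ultimately show ?thesis
    unfolding h_def P_def q_def by simp
qed

end
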